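(* Let $(\mathcal{A},\bullet,\omega)$ be a pre-symplectic left-symmetric algebra over an algebraically closed field $\mathbb{K}$ such that the commutator ideal $[\mathcal{A},\mathcal{A}]$ is degenerate with respect to $\omega$. Then there exists a $1$-dimensional totally isotropic two-sided ideal $I$ of $(\mathcal{A},\bullet)$ such that $I\subseteq[\mathcal{A},\mathcal{A}]\cap[\mathcal{A},\mathcal{A}]^\perp$. Moreover, $(\mathcal{A},\bullet,\omega)$ is a double extension of $(\mathcal{B}:=I^\perp/I,\bullet_{\mathcal{B}},\omega_{\mathcal{B}})$ by the $1$-dimensional algebra $\mathfrak{h}:=\mathcal{A}/I^\perp\simeq\mathbb{K}d$, by means of some data $(D,\xi,b_0,\lambda)$.
   Context: $\mathbb{K}$ has characteristic $0$; all vector spaces are finite-dimensional. $[u,v]_\bullet=u\bullet v-v\bullet u$, $[\mathcal{A},\mathcal{A}]=\mathrm{span}\{[u,v]_\bullet\}$. A pre-symplectic left-symmetric algebra is a triple $(\mathcal{A},\bullet,\omega)$ where $(u\bullet v)\bullet w-u\bullet(v\bullet w)=(v\bullet u)\bullet w-v\bullet(u\bullet w)$ and $\omega$ is a nondegenerate skew-symmetric bilinear form with $\omega(u\bullet v,w)=\omega(v,u\bullet w)$ for all $u,v,w$ (the zero space is allowed). $F^\perp$ is the $\omega$-orthogonal; $F$ is degenerate if $F\cap F^\perp\ne\{0\}$, totally isotropic if $F\subset F^\perp$. For a two-sided ideal $I\subseteq[\mathcal{A},\mathcal{A}]\cap[\mathcal{A},\mathcal{A}]^\perp$, $I^\perp$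 is a two-sided ideal; $I^\perp/I$ carries the induced product $\bullet_{\mathcal{B}}$ and form $\omega_{\mathcal{B}}$ (it is pre-symplectic left-symmetric), and $\mathcal{A}/I^\perp$ carries the induced (commutative associative) product. Double extension by a one-dimensional algebra $\mathfrak{h}=\mathbb{K}d$, $d\circ d=\lambda d$: data on $(\mathcal{B},\bullet_{\mathcal{B}},\omega_{\mathcal{B}})$ are $\xi,D\in\mathrm{End}(\mathcal{B})$, $b_0\in\mathcal{B}$, $\lambda\in\mathbb{K}$, with $\xi$ symmetric w.r.t. $\omega_{\mathcal{B}}$ and, for all $u,v\in\mathcal{B}$ (writing $\bullet$ for $\bullet_{\mathcal{B}}$, $T^*$ for the adjoint w.r.t. $\omega_{\mathcal{B}}$): $D([u,v]_\bullet)=0$; $u\bullet D(v)=v\bullet D(u)$; $D(u)\bullet v=\xi(u)\bullet v$; $\xi(u\bullet v)=u\bullet\xi(v)$; $\xi(D(u))=\lambda D(u)+u\bullet b_0$; $D^2=D\circ\xi$; $D^*\circ D=0$; $D^*(b_0)=0$. The double extension is $\mathbb{K}d\oplus\mathcal{B}\oplus\mathbb{K}e$ with $d\bullet e=\lambda e$, $d\bullet u=\xi(u)-\omega_{\mathcal{B}}(b_0,u)e$, $u\bullet d=D(u)$, $d\bullet d=\lambda d+b_0$, $u\bullet v=u\bullet_{\mathcal{B}}v-\omega_{\mathcal{B}}(D(u),v)e$, other products ($e\bullet x$, $u\bullet e$) zero, and $\omega|_{\mathcal{B}\times\mathcal{B}}=\omega_{\mathcal{B}}$, $\omega(e,d)=-\omega(d,e)=1$,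 $\omega(d,\mathcal{B})=\omega(e,\mathcal{B})=0$. "Is a double extension" means isomorphic to such an algebra by an algebra isomorphism preserving the forms. *)

theory Defs
  imports "HOL-Algebra.Algebra"
begin

text \<open>
  An algebra over a field is a \<^typ>\<open>('k, 'a) module\<close> record whose field \<^const>\<open>monoid.mult\<close> holds the
  (nonassociative, nonunital) product; the record field \<^const>\<open>one\<close> is never used.
\<close>

definition lin_span :: "('k, 'm) ring_scheme \<Rightarrow> ('k, 'a, 'n) module_scheme \<Rightarrow> 'a set \<Rightarrow> 'a set"
  where "lin_span K V S = \<Inter>{H. submodule H K V \<and> S \<subseteq> H}"

definition fin_dim :: "('k, 'm) ring_scheme \<Rightarrow> ('k, 'a, 'n) module_scheme \<Rightarrow> bool"
  where "fin_dim K V \<longleftrightarrow> (\<exists>S. finite S \<and> S \<subseteq> carrier V \<and> lin_span K V S = carrier V)"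

definition one_dimensional ::
    "('k, 'm) ring_scheme \<Rightarrow> ('k, 'a, 'n) module_scheme \<Rightarrow> 'a set \<Rightarrow> bool"
  where "one_dimensional K V F \<longleftrightarrow>
    (\<exists>x \<in> carrier V. x \<noteq> \<zero>\<^bsub>V\<^esub> \<and> F = {a \<odot>\<^bsub>V\<^esub> x | a. a \<in> carrier K})"

definition lin_End ::
    "('k, 'm) ring_scheme \<Rightarrow> ('k, 'a, 'n) module_scheme \<Rightarrow> ('a \<Rightarrow> 'a) set"
  where "lin_End K V = {T \<in> carrier V \<rightarrow> carrier V.
    (\<forall>x \<in> carrier V. \<forall>y \<in> carrier V. T (x \<oplus>\<^bsub>V\<^esub> y) = T x \<oplus>\<^bsub>V\<^esub> T y) \<and>
    (\<forall>a \<in> carrier K. \<forall>x \<in> carrier V. T (a \<odot>\<^bsub>V\<^esub> x) = a \<odot>\<^bsub>V\<^esub> T x)}"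

definition char_zero :: "('k, 'm) ring_scheme \<Rightarrow> bool"
  where "char_zero K \<longleftrightarrow> (\<forall>n::nat. 0 < n \<longrightarrow> [n] \<cdot>\<^bsub>K\<^esub> \<one>\<^bsub>K\<^esub> \<noteq> \<zero>\<^bsub>K\<^esub>)"

locale fd_algebra = field K + module K A for K (structure) and A (structure) +
  assumes fin_dim: "fin_dim K A"
    and prod_closed: "\<lbrakk>u \<in> carrier A; v \<in> carrier A\<rbrakk> \<Longrightarrow> u \<otimes>\<^bsub>A\<^esub> v \<in> carrier A"
    and prod_add_left: "\<lbrakk>u \<in> carrier A; v \<in> carrier A; w \<in> carrier A\<rbrakk> \<Longrightarrow>
      (u \<oplus>\<^bsub>A\<^esub> v) \<otimes>\<^bsub>A\<^esub> w = u \<otimes>\<^bsub>A\<^esub> w \<oplus>\<^bsub>A\<^esub> v \<otimes>\<^bsub>A\<^esub> w"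
    and prod_add_right: "\<lbrakk>u \<in> carrier A; v \<in> carrier A; w \<in> carrier A\<rbrakk> \<Longrightarrow>
      u \<otimes>\<^bsub>A\<^esub> (v \<oplus>\<^bsub>A\<^esub> w) = u \<otimes>\<^bsub>A\<^esub> v \<oplus>\<^bsub>A\<^esub> u \<otimes>\<^bsub>A\<^esub> w"
    and prod_smult_left: "\<lbrakk>a \<in> carrier K; u \<in> carrier A; v \<in> carrier A\<rbrakk> \<Longrightarrow>
      (a \<odot>\<^bsub>A\<^esub> u) \<otimes>\<^bsub>A\<^esub> v = a \<odot>\<^bsub>A\<^esub> (u \<otimes>\<^bsub>A\<^esub> v)"
    and prod_smult_right: "\<lbrakk>a \<in> carrier K; u \<in> carrier A; v \<in> carrier A\<rbrakk> \<Longrightarrow>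
      u \<otimes>\<^bsub>A\<^esub> (a \<odot>\<^bsub>A\<^esub> v) = a \<odot>\<^bsub>A\<^esub> (u \<otimes>\<^bsub>A\<^esub> v)"

locale left_symmetric_algebra = fd_algebra +
  assumes left_symmetric: "\<lbrakk>u \<in> carrier A; v \<in> carrier A; w \<in> carrier A\<rbrakk> \<Longrightarrow>
      (u \<otimes>\<^bsub>A\<^esub> v) \<otimes>\<^bsub>A\<^esub> w \<ominus>\<^bsub>A\<^esub> u \<otimes>\<^bsub>A\<^esub> (v \<otimes>\<^bsub>A\<^esub> w) =
      (v \<otimes>\<^bsub>A\<^esub> u) \<otimes>\<^bsub>A\<^esub> w \<ominus>\<^bsub>A\<^esub> v \<otimes>\<^bsub>A\<^esub> (u \<otimes>\<^bsub>A\<^esub> w)"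

text \<open>Nondegeneracy is required on one side only; skew-symmetry gives the other side.\<close>

locale presymplectic_lsa = left_symmetric_algebra +
  fixes \<omega> :: "'c \<Rightarrow> 'c \<Rightarrow> 'a"
  assumes form_closed: "\<lbrakk>u \<in> carrier A; v \<in> carrier A\<rbrakk> \<Longrightarrow> \<omega> u v \<in> carrier K"
    and form_add_left: "\<lbrakk>u \<in> carrier A; v \<in> carrier A; w \<in> carrier A\<rbrakk> \<Longrightarrow>
      \<omega> (u \<oplus>\<^bsub>A\<^esub> v) w = \<omega> u w \<oplus>\<^bsub>K\<^esub> \<omega> v w"
    and form_add_right: "\<lbrakk>u \<in> carrier A; v \<in> carrier A; w \<in> carrier A\<rbrakk> \<Longrightarrow>
      \<omega> u (v \<oplus>\<^bsub>A\<^esub> w) = \<omega> u v \<oplus>\<^bsub>K\<^esub> \<omega> u w"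
    and form_smult_left: "\<lbrakk>a \<in> carrier K; u \<in> carrier A; v \<in> carrier A\<rbrakk> \<Longrightarrow>
      \<omega> (a \<odot>\<^bsub>A\<^esub> u) v = a \<otimes>\<^bsub>K\<^esub> \<omega> u v"
    and form_smult_right: "\<lbrakk>a \<in> carrier K; u \<in> carrier A; v \<in> carrier A\<rbrakk> \<Longrightarrow>
      \<omega> u (a \<odot>\<^bsub>A\<^esub> v) = a \<otimes>\<^bsub>K\<^esub> \<omega> u v"
    and form_skew: "\<lbrakk>u \<in> carrier A; v \<in> carrier A\<rbrakk> \<Longrightarrow> \<omega> u v = \<ominus>\<^bsub>K\<^esub> \<omega> v u"
    and form_nondegenerate: "\<lbrakk>u \<in> carrier A; \<And>v. v \<in> carrier A \<Longrightarrow> \<omega> u v = \<zero>\<^bsub>K\<^esub>\<rbrakk> \<Longrightarrow>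
      u = \<zero>\<^bsub>A\<^esub>"
    and form_compatible: "\<lbrakk>u \<in> carrier A; v \<in> carrier A; w \<in> carrier A\<rbrakk> \<Longrightarrow>
      \<omega> (u \<otimes>\<^bsub>A\<^esub> v) w = \<omega> v (u \<otimes>\<^bsub>A\<^esub> w)"

definition commutator :: "('k, 'a) module \<Rightarrow> 'a \<Rightarrow> 'a \<Rightarrow> 'a"
  where "commutator A u v = u \<otimes>\<^bsub>A\<^esub> v \<ominus>\<^bsub>A\<^esub> v \<otimes>\<^bsub>A\<^esub> u"

definition commutator_ideal :: "('k, 'm) ring_scheme \<Rightarrow> ('k, 'a) module \<Rightarrow> 'a set"
  where "commutator_ideal K A =
    lin_span K A {commutator A u v | u v. u \<in> carrier A \<and> v \<in> carrier A}"

definition two_sided_ideal :: "('k, 'm) ring_scheme \<Rightarrow> ('k, 'a) module \<Rightarrow> 'a set \<Rightarrow> bool"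
  where "two_sided_ideal K A I \<longleftrightarrow> submodule I K A \<and>
    (\<forall>x \<in> I. \<forall>u \<in> carrier A. u \<otimes>\<^bsub>A\<^esub> x \<in> I \<and> x \<otimes>\<^bsub>A\<^esub> u \<in> I)"

definition orth ::
    "('k, 'm) ring_scheme \<Rightarrow> ('k, 'a) module \<Rightarrow> ('a \<Rightarrow> 'a \<Rightarrow> 'k) \<Rightarrow> 'a set \<Rightarrow> 'a set"
  where "orth K A \<omega> F = {u \<in> carrier A. \<forall>v \<in> F. \<omega> u v = \<zero>\<^bsub>K\<^esub>}"

definition degenerate ::
    "('k, 'm) ring_scheme \<Rightarrow> ('k, 'a) module \<Rightarrow> ('a \<Rightarrow> 'a \<Rightarrow> 'k) \<Rightarrow> 'a set \<Rightarrow> bool"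
  where "degenerate K A \<omega> F \<longleftrightarrow> F \<inter> orth K A \<omega> F \<noteq> {\<zero>\<^bsub>A\<^esub>}"

definition totally_isotropic ::
    "('k, 'm) ring_scheme \<Rightarrow> ('k, 'a) module \<Rightarrow> ('a \<Rightarrow> 'a \<Rightarrow> 'k) \<Rightarrow> 'a set \<Rightarrow> bool"
  where "totally_isotropic K A \<omega> F \<longleftrightarrow> F \<subseteq> orth K A \<omega> F"

definition subalg :: "('k, 'a) module \<Rightarrow> 'a set \<Rightarrow> ('k, 'a) module"
  where "subalg A S = A\<lparr>carrier := S\<rparr>"

text \<open>
  In the quotient algebra the summand \<open>I\<close> in the scalar multiplication is needed because
  \<open>0 \<cdot> (x + I)\<close>, computed elementwise, would be \<open>{0}\<close> and not the coset \<open>I\<close>.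
\<close>

definition quot_alg :: "('k, 'a) module \<Rightarrow> 'a set \<Rightarrow> ('k, 'a set) module"
  where "quot_alg A I =
    \<lparr>carrier = carrier (A Quot I), monoid.mult = monoid.mult (A Quot I), one = one (A Quot I),
     ring.zero = ring.zero (A Quot I), ring.add = ring.add (A Quot I),
     module.smult = (\<lambda>a S. I <+>\<^bsub>A\<^esub> ((\<lambda>x. a \<odot>\<^bsub>A\<^esub> x) ` S))\<rparr>"

definition quot_form :: "('a \<Rightarrow> 'a \<Rightarrow> 'k) \<Rightarrow> 'a set \<Rightarrow> 'a set \<Rightarrow> 'k"
  where "quot_form \<omega> S T = (THE c. \<exists>x \<in> S. \<exists>y \<in> T. c = \<omega> x y)"

definition adjoint ::
    "('k, 'a) module \<Rightarrow> ('a \<Rightarrow> 'a \<Rightarrow> 'k) \<Rightarrow> ('a \<Rightarrow> 'a) \<Rightarrow> 'a \<Rightarrow> 'a"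
  where "adjoint B \<omega> T v =
    (THE w. w \<in> carrier B \<and> (\<forall>u \<in> carrier B. \<omega> (T u) v = \<omega> u w))"

locale double_extension_data = presymplectic_lsa K B \<omega>
  for K (structure) and B :: "('a, 'c) module" (structure) and \<omega> :: "'c \<Rightarrow> 'c \<Rightarrow> 'a" +
  fixes D \<xi> :: "'c \<Rightarrow> 'c" and b0 :: 'c and lam :: 'a
  assumes D_End: "D \<in> lin_End K B"
    and xi_End: "\<xi> \<in> lin_End K B"
    and b0_closed: "b0 \<in> carrier B"
    and lam_closed: "lam \<in> carrier K"
    and xi_symmetric: "\<lbrakk>u \<in> carrier B; v \<in> carrier B\<rbrakk> \<Longrightarrow> \<omega> (\<xi> u) v = \<omega> u (\<xi> v)"
    and D_commutator: "\<lbrakk>u \<in> carrier B; v \<in> carrier B\<rbrakk> \<Longrightarrow> D (commutator B u v) = \<zero>\<^bsub>B\<^esub>"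
    and prod_D_right: "\<lbrakk>u \<in> carrier B; v \<in> carrier B\<rbrakk> \<Longrightarrow> u \<otimes>\<^bsub>B\<^esub> D v = v \<otimes>\<^bsub>B\<^esub> D u"
    and prod_D_left: "\<lbrakk>u \<in> carrier B; v \<in> carrier B\<rbrakk> \<Longrightarrow> D u \<otimes>\<^bsub>B\<^esub> v = \<xi> u \<otimes>\<^bsub>B\<^esub> v"
    and xi_prod: "\<lbrakk>u \<in> carrier B; v \<in> carrier B\<rbrakk> \<Longrightarrow> \<xi> (u \<otimes>\<^bsub>B\<^esub> v) = u \<otimes>\<^bsub>B\<^esub> \<xi> v"
    and xi_D: "u \<in> carrier B \<Longrightarrow> \<xi> (D u) = lam \<odot>\<^bsub>B\<^esub> D u \<oplus>\<^bsub>B\<^esub> u \<otimes>\<^bsub>B\<^esub> b0"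
    and D_D: "u \<in> carrier B \<Longrightarrow> D (D u) = D (\<xi> u)"
    and adjoint_D_D: "u \<in> carrier B \<Longrightarrow> adjoint B \<omega> D (D u) = \<zero>\<^bsub>B\<^esub>"
    and adjoint_D_b0: "adjoint B \<omega> D b0 = \<zero>\<^bsub>B\<^esub>"

text \<open>The algebra \<open>\<KK>d\<close> with \<open>d \<circ> d = lam d\<close>; the scalar \<open>a\<close> stands for \<open>a d\<close>.\<close>

definition line_alg :: "('k, 'm) ring_scheme \<Rightarrow> 'k \<Rightarrow> ('k, 'k) module"
  where "line_alg K lam =
    \<lparr>carrier = carrier K, monoid.mult = (\<lambda>a a'. lam \<otimes>\<^bsub>K\<^esub> (a \<otimes>\<^bsub>K\<^esub> a')), one = undefined,
     ring.zero = \<zero>\<^bsub>K\<^esub>, ring.add = (\<oplus>\<^bsub>K\<^esub>), module.smult = (\<otimes>\<^bsub>K\<^esub>)\<rparr>"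

text \<open>
  The triple \<open>(a, u, c)\<close> stands for \<open>a d + u + c e\<close> in \<open>\<KK>d \<oplus> B \<oplus> \<KK>e\<close>. The product and the
  form are the bilinear extensions of
  \<open>d \<bullet> d = lam d + b0\<close>, \<open>d \<bullet> e = lam e\<close>, \<open>d \<bullet> u = \<xi> u - \<omega> b0 u e\<close>, \<open>u \<bullet> d = D u\<close>,
  \<open>u \<bullet> v = u \<bullet>\<^sub>B v - \<omega> (D u) v e\<close> (other products zero), and of \<open>\<omega>\<close> on \<open>B\<close> together with
  \<open>\<omega> e d = - \<omega> d e = 1\<close>.
\<close>

definition double_ext_alg :: "('k, 'm) ring_scheme \<Rightarrow> ('k, 'b) module \<Rightarrow> ('b \<Rightarrow> 'b \<Rightarrow> 'k) \<Rightarrow>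
    ('b \<Rightarrow> 'b) \<Rightarrow> ('b \<Rightarrow> 'b) \<Rightarrow> 'b \<Rightarrow> 'k \<Rightarrow> ('k, 'k \<times> 'b \<times> 'k) module"
  where "double_ext_alg K B \<omega> D \<xi> b0 lam =
    \<lparr>carrier = carrier K \<times> carrier B \<times> carrier K,
     monoid.mult = (\<lambda>(a, u, c) (a', u', c').
       (lam \<otimes>\<^bsub>K\<^esub> (a \<otimes>\<^bsub>K\<^esub> a'),
        (a \<otimes>\<^bsub>K\<^esub> a') \<odot>\<^bsub>B\<^esub> b0 \<oplus>\<^bsub>B\<^esub> a \<odot>\<^bsub>B\<^esub> \<xi> u' \<oplus>\<^bsub>B\<^esub> a' \<odot>\<^bsub>B\<^esub> D u \<oplus>\<^bsub>B\<^esub> u \<otimes>\<^bsub>B\<^esub> u',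
        lam \<otimes>\<^bsub>K\<^esub> (a \<otimes>\<^bsub>K\<^esub> c') \<ominus>\<^bsub>K\<^esub> a \<otimes>\<^bsub>K\<^esub> \<omega> b0 u' \<ominus>\<^bsub>K\<^esub> \<omega> (D u) u')),
     one = undefined,
     ring.zero = (\<zero>\<^bsub>K\<^esub>, \<zero>\<^bsub>B\<^esub>, \<zero>\<^bsub>K\<^esub>),
     ring.add = (\<lambda>(a, u, c) (a', u', c'). (a \<oplus>\<^bsub>K\<^esub> a', u \<oplus>\<^bsub>B\<^esub> u', c \<oplus>\<^bsub>K\<^esub> c')),
     module.smult = (\<lambda>k (a, u, c). (k \<otimes>\<^bsub>K\<^esub> a, k \<odot>\<^bsub>B\<^esub> u, k \<otimes>\<^bsub>K\<^esub> c))\<rparr>"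

definition double_ext_form :: "('k, 'm) ring_scheme \<Rightarrow> ('b \<Rightarrow> 'b \<Rightarrow> 'k) \<Rightarrow>
    'k \<times> 'b \<times> 'k \<Rightarrow> 'k \<times> 'b \<times> 'k \<Rightarrow> 'k"
  where "double_ext_form K \<omega> =
    (\<lambda>(a, u, c) (a', u', c'). \<omega> u u' \<oplus>\<^bsub>K\<^esub> (c \<otimes>\<^bsub>K\<^esub> a' \<ominus>\<^bsub>K\<^esub> a \<otimes>\<^bsub>K\<^esub> c'))"

definition alg_iso ::
    "('k, 'm) ring_scheme \<Rightarrow> ('k, 'a) module \<Rightarrow> ('k, 'b) module \<Rightarrow> ('a \<Rightarrow> 'b) set"
  where "alg_iso K A A' = {f. bij_betw f (carrier A) (carrier A') \<and>
    (\<forall>x \<in> carrier A. \<forall>y \<in> carrier A. f (x \<oplus>\<^bsub>A\<^esub> y) = f x \<oplus>\<^bsub>A'\<^esub> f y) \<and>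
    (\<forall>a \<in> carrier K. \<forall>x \<in> carrier A. f (a \<odot>\<^bsub>A\<^esub> x) = a \<odot>\<^bsub>A'\<^esub> f x) \<and>
    (\<forall>x \<in> carrier A. \<forall>y \<in> carrier A. f (x \<otimes>\<^bsub>A\<^esub> y) = f x \<otimes>\<^bsub>A'\<^esub> f y)}"

definition is_double_extension :: "('k, 'm) ring_scheme \<Rightarrow>
    ('k, 'a) module \<Rightarrow> ('a \<Rightarrow> 'a \<Rightarrow> 'k) \<Rightarrow> ('k, 'b) module \<Rightarrow> ('b \<Rightarrow> 'b \<Rightarrow> 'k) \<Rightarrow>
    ('b \<Rightarrow> 'b) \<Rightarrow> ('b \<Rightarrow> 'b) \<Rightarrow> 'b \<Rightarrow> 'k \<Rightarrow> bool"
  where "is_double_extension K A \<omega> B \<omega>\<^sub>B D \<xi> b0 lam \<longleftrightarrow>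
    double_extension_data K B \<omega>\<^sub>B D \<xi> b0 lam \<and>
    (\<exists>f \<in> alg_iso K A (double_ext_alg K B \<omega>\<^sub>B D \<xi> b0 lam).
       \<forall>x \<in> carrier A. \<forall>y \<in> carrier A. double_ext_form K \<omega>\<^sub>B (f x) (f y) = \<omega> x y)"

end

theory Submission
  imports Defs
begin

text \<open>
  Write \<open>L\<^sub>u\<close> for the left multiplication by \<open>u\<close> and \<open>C = [A,A]\<close>. Compatibility of \<open>\<omega>\<close> says that every
  \<open>L\<^sub>u\<close> is symmetric. Left symmetry says that \<open>L\<close> of a commutator is the commutator of the left
  multiplications, and a commutator of symmetric maps is skew. So \<open>L\<close> of a commutator is both
  symmetric and skew, hence zero in characteristic \<open>0\<close>: \<open>C \<bullet> A = 0\<close>, and all \<open>L\<^sub>u\<close> commute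
  (\<open>left_mult_commutator_commute\<close>). For \<open>c \<in> C\<close> it follows that \<open>u \<bullet> c = [u, c]\<close>, so \<open>C\<close> is invariant
  under left multiplications, and so is \<open>C\<^sup>\<perp>\<close> by symmetry.

  If \<open>C\<close> is degenerate, the commuting maps \<open>L\<^sub>u\<close> act on \<open>C \<inter> C\<^sup>\<perp> \<noteq> 0\<close> and have a common eigenvector \<open>e\<close>
  there, because \<open>K\<close> is algebraically closed (\<open>ex_common_eigenvector\<close>). As \<open>e \<bullet> A = 0\<close>, the line \<open>I\<close>
  spanned by \<open>e\<close> is a two-sided ideal. Choose \<open>d\<close> with \<open>\<omega>(e, d) = 1\<close> and let \<open>lam\<close> be the eigenvalue of
  \<open>L\<^sub>d\<close> at \<open>e\<close>. Since \<open>e \<in> C\<^sup>\<perp>\<close>, the eigenvalue of \<open>L\<^sub>u\<close> at \<open>e\<close> is \<open>lam \<omega>(e, u)\<close> for all \<open>u\<close>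
  (\<open>ex_invariant_line\<close>). Therefore \<open>\<omega>(e, u \<bullet> v) = lam \<omega>(e, u) \<omega>(e, v)\<close>, which makes \<open>H = I\<^sup>\<perp>\<close> an ideal and
  \<open>\<omega> e\<close> a coordinate identifying \<open>A/H\<close> with \<open>K d\<close>, where \<open>d \<circ> d = lam d\<close>.

  On \<open>B = H/I\<close> the maps \<open>D\<close> and \<open>\<xi>\<close> are induced by right and left multiplication by \<open>d\<close>, and \<open>b\<^sub>0\<close> is the
  class of \<open>d \<bullet> d - lam d\<close>. The identities required of the data are instances of
  \<open>(u \<bullet> v) \<bullet> w = (v \<bullet> u) \<bullet> w\<close>, \<open>u \<bullet> (v \<bullet> w) = v \<bullet> (u \<bullet> w)\<close> and of the vanishing of
  \<open>\<omega>(x \<bullet> v, y \<bullet> v)\<close>. The isomorphism sends \<open>x\<close> to its coordinate \<open>\<omega>(e, x)\<close> along \<open>d\<close>, the class in \<open>B\<close> of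
  its projection to \<open>H\<close> along \<open>d\<close>, and its coordinate \<open>\<omega>(x, d)\<close> along \<open>e\<close>. No complement of \<open>I\<close> in \<open>H\<close>
  is chosen: the third coordinate recovers what passing to the quotient forgets.
\<close>

section \<open>Rearranging sums and differences\<close>

lemma (in abelian_group) minus_add_cancel_left:
  assumes "x \<in> carrier G" "y \<in> carrier G" "z \<in> carrier G"
  shows "(x \<oplus> y) \<ominus> (x \<oplus> z) = y \<ominus> z"
proof -
  have "(x \<oplus> y) \<ominus> (x \<oplus> z) = (x \<oplus> \<ominus> x) \<oplus> (y \<oplus> \<ominus> z)"
    using assms by (simp add: a_minus_def minus_add a_ac del: r_neg l_neg)
  then show ?thesis using assms by (simp add: a_minus_def r_neg)
qed

lemma (in abelian_group) minus_zero_right: "x \<in> carrier G \<Longrightarrow> x \<ominus> \<zero> = x"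
  by (simp add: a_minus_def)

lemma (in abelian_group) minus_add_regroup:
  assumes "a \<in> carrier G" "b \<in> carrier G" "c \<in> carrier G" "d \<in> carrier G" "x \<in> carrier G"
  shows "(a \<ominus> b) \<oplus> c \<oplus> d = (a \<oplus> c) \<ominus> (b \<oplus> x) \<oplus> (x \<oplus> d)"
proof -
  have "(a \<oplus> c) \<ominus> (b \<oplus> x) \<oplus> (x \<oplus> d) = (x \<oplus> \<ominus> x) \<oplus> ((a \<ominus> b) \<oplus> c \<oplus> d)"
    using assms by (simp add: a_minus_def minus_add a_ac del: r_neg l_neg)
  then show ?thesis using assms by (simp add: a_minus_def r_neg)
qed

lemma (in abelian_group) minus_eq_zero_iff:
  assumes "x \<in> carrier G" "y \<in> carrier G"
  shows "x \<ominus> y = \<zero> \<longleftrightarrow> x = y"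
  using assms minus_equality[of x "\<ominus> y"] by (auto simp: a_minus_def r_neg)

lemma (in ring) minus_diff_swap:
  assumes "a \<in> carrier R" "b \<in> carrier R"
  shows "\<ominus> (a \<ominus> b) = b \<ominus> a"
  using assms by (simp add: a_minus_def minus_add a_comm)

lemma (in abelian_group) minus_swap:
  assumes "a \<ominus> b = c \<ominus> d" "a \<in> carrier G" "b \<in> carrier G" "c \<in> carrier G" "d \<in> carrier G"
  shows "a \<ominus> c = b \<ominus> d"
proof -
  have "a \<ominus> c = (a \<ominus> b) \<oplus> b \<ominus> c" using assms(2-) by (simp add: a_minus_def a_assoc l_neg)
  also have "\<dots> = (c \<ominus> d) \<oplus> b \<ominus> c" unfolding assms(1) ..
  also have "\<dots> = (c \<oplus> (b \<ominus> d)) \<ominus> (c \<oplus> \<zero>)" using assms by (simp add: a_minus_def a_ac)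
  also have "\<dots> = (b \<ominus> d) \<ominus> \<zero>" using assms by (intro minus_add_cancel_left) auto
  finally show ?thesis using assms by (simp add: a_minus_def)
qed

lemma (in abelian_group) add_minus_cancel:
  assumes "x \<in> carrier G" "y \<in> carrier G"
  shows "(x \<oplus> y) \<ominus> x = y"
proof -
  have "(x \<oplus> y) \<ominus> (x \<oplus> \<zero>) = y \<ominus> \<zero>" using assms by (intro minus_add_cancel_left) auto
  then show ?thesis using assms by (simp add: minus_zero_right)
qed

lemma (in ring) add_diff_self:
  assumes "x \<in> carrier R" "y \<in> carrier R"
  shows "x \<oplus> (y \<ominus> x) = y"
  using assms by (simp add: a_minus_def a_comm[of y] r_neg2)

lemma (in ring) add_rotate:
  assumes "x \<in> carrier R" "y \<in> carrier R" "z \<in> carrier R"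
  shows "x \<oplus> (y \<oplus> z) = z \<oplus> (x \<oplus> y)"
  using assms by (simp add: a_ac)

section \<open>Finite-dimensional linear algebra\<close>

locale linear_space = field K + module K V for K (structure) and V (structure)

lemma (in module) lin_span_least:
  assumes "submodule H R M" "S \<subseteq> H"
  shows "lin_span R M S \<subseteq> H"
  using assms unfolding lin_span_def by auto

lemma lin_span_incl: "x \<in> S \<Longrightarrow> x \<in> lin_span K V S"
  unfolding lin_span_def by auto

lemma (in module) submodule_closed:
  assumes "submodule H R M"
  shows "x \<in> H \<Longrightarrow> x \<in> carrier M"
    and "\<zero>\<^bsub>M\<^esub> \<in> H"
    and "x \<in> H \<Longrightarrow> y \<in> H \<Longrightarrow> x \<oplus>\<^bsub>M\<^esub> y \<in> H"
    and "x \<in> H \<Longrightarrow> y \<in> H \<Longrightarrow> x \<ominus>\<^bsub>M\<^esub> y \<in> H"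
    and "a \<in> carrier R \<Longrightarrow> x \<in> H \<Longrightarrow> a \<odot>\<^bsub>M\<^esub> x \<in> H"
proof -
  show "\<zero>\<^bsub>M\<^esub> \<in> H"
    using subgroup.one_closed[OF submodule.axioms(1)[OF assms]] by simp
qed (use submoduleE[OF assms] in \<open>auto simp: a_minus_def\<close>)

lemma (in module) submoduleI_smult:
  assumes "H \<subseteq> carrier M" "\<zero>\<^bsub>M\<^esub> \<in> H"
    and "\<And>x y. x \<in> H \<Longrightarrow> y \<in> H \<Longrightarrow> x \<oplus>\<^bsub>M\<^esub> y \<in> H"
    and smult: "\<And>a x. a \<in> carrier R \<Longrightarrow> x \<in> H \<Longrightarrow> a \<odot>\<^bsub>M\<^esub> x \<in> H"
  shows "submodule H R M"
proof (rule submoduleI)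
  fix x assume x: "x \<in> H"
  then have "(\<ominus>\<^bsub>R\<^esub> \<one>\<^bsub>R\<^esub>) \<odot>\<^bsub>M\<^esub> x = \<ominus>\<^bsub>M\<^esub> x"
    using assms(1) smult_l_minus[of "\<one>\<^bsub>R\<^esub>" x] by auto
  then show "\<ominus>\<^bsub>M\<^esub> x \<in> H"
    using smult[of "\<ominus>\<^bsub>R\<^esub> \<one>\<^bsub>R\<^esub>" x] x by simp
qed (use assms in auto)

lemma (in module) lin_span_submodule:
  assumes "S \<subseteq> carrier M"
  shows "submodule (lin_span R M S) R M"
proof (rule submoduleI_smult)
  show "lin_span R M S \<subseteq> carrier M"
    using assms carrier_is_submodule by (rule_tac lin_span_least)
qed (auto simp: lin_span_def dest: submodule_closed)

lemma (in module) lin_span_insertE: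
  assumes "s \<in> carrier M" "S \<subseteq> carrier M" "x \<in> lin_span R M (insert s S)"
  obtains c y where "c \<in> carrier R" "y \<in> lin_span R M S" "x = c \<odot>\<^bsub>M\<^esub> s \<oplus>\<^bsub>M\<^esub> y"
proof -
  let ?H = "{c \<odot>\<^bsub>M\<^esub> s \<oplus>\<^bsub>M\<^esub> y | c y. c \<in> carrier R \<and> y \<in> lin_span R M S}"
  note sub = lin_span_submodule[OF assms(2)]
  note [simp] = submodule_closed[OF sub] assms(1)
  have "submodule ?H R M"
  proof (rule submoduleI_smult)
    show "\<zero>\<^bsub>M\<^esub> \<in> ?H"
      by (rule CollectI, rule exI[of _ "\<zero>\<^bsub>R\<^esub>"], rule exI[of _ "\<zero>\<^bsub>M\<^esub>"]) simp
  next
    fix x y assume "x \<in> ?H" "y \<in> ?H"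
    then obtain c u c' u' where cu: "c \<in> carrier R" "u \<in> lin_span R M S" "c' \<in> carrier R"
        "u' \<in> lin_span R M S" "x = c \<odot>\<^bsub>M\<^esub> s \<oplus>\<^bsub>M\<^esub> u" "y = c' \<odot>\<^bsub>M\<^esub> s \<oplus>\<^bsub>M\<^esub> u'" by blast
    then have "x \<oplus>\<^bsub>M\<^esub> y = (c \<oplus>\<^bsub>R\<^esub> c') \<odot>\<^bsub>M\<^esub> s \<oplus>\<^bsub>M\<^esub> (u \<oplus>\<^bsub>M\<^esub> u')"
      by (simp add: smult_l_distr M.a_ac)
    then show "x \<oplus>\<^bsub>M\<^esub> y \<in> ?H" using cu by (auto intro!: exI)
  next
    fix a x assume a: "a \<in> carrier R" and "x \<in> ?H"
    then obtain c u where cu: "c \<in> carrier R" "u \<in> lin_span R M S" "x = c \<odot>\<^bsub>M\<^esub> s \<oplus>\<^bsub>M\<^esub> u"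
      by blast
    then have "a \<odot>\<^bsub>M\<^esub> x = (a \<otimes>\<^bsub>R\<^esub> c) \<odot>\<^bsub>M\<^esub> s \<oplus>\<^bsub>M\<^esub> a \<odot>\<^bsub>M\<^esub> u"
      using a by (simp add: smult_r_distr smult_assoc1)
    then show "a \<odot>\<^bsub>M\<^esub> x \<in> ?H" using cu a by (auto intro!: exI)
  qed auto
  moreover have "insert s S \<subseteq> ?H"
  proof safe
    show "\<exists>c y. s = c \<odot>\<^bsub>M\<^esub> s \<oplus>\<^bsub>M\<^esub> y \<and> c \<in> carrier R \<and> y \<in> lin_span R M S"
      by (rule exI[of _ "\<one>\<^bsub>R\<^esub>"], rule exI[of _ "\<zero>\<^bsub>M\<^esub>"]) simp
    fix x assume "x \<in> S"
    then have "x \<in> lin_span R M S" by (rule lin_span_incl)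
    then show "\<exists>c y. x = c \<odot>\<^bsub>M\<^esub> s \<oplus>\<^bsub>M\<^esub> y \<and> c \<in> carrier R \<and> y \<in> lin_span R M S"
      by (intro exI[of _ "\<zero>\<^bsub>R\<^esub>"] exI[of _ "x"]) simp
  qed
  ultimately show ?thesis using assms(3) lin_span_least that by blast
qed

text \<open>
  Gaussian elimination in disguise: the first \<open>w m\<close> with a nonzero coefficient at \<open>s\<close> clears
  that coefficient from all later terms, which leaves a sequence in a smaller span.
\<close>

lemma (in linear_space) sequence_dependent:
  assumes "finite S" "S \<subseteq> carrier V" "\<And>i. w i \<in> lin_span K V S"
  shows "\<exists>n::nat. w n \<in> lin_span K V (w ` {..<n})"
  using assms
proof (induction S arbitrary: w rule: finite_induct)
  case empty
  have "submodule {\<zero>\<^bsub>V\<^esub>} K V" by (rule submoduleI_smult) auto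
  then have "lin_span K V {} \<subseteq> {\<zero>\<^bsub>V\<^esub>}" by (rule lin_span_least) auto
  then have "w 0 = \<zero>\<^bsub>V\<^esub>" using empty(2)[of 0] by auto
  then show ?case
    using submodule_closed(2)[OF lin_span_submodule[of "{}"]] by (intro exI[of _ 0]) auto
next
  case (insert s S)
  note sub = lin_span_submodule[of S]
  have "\<exists>c y. c \<in> carrier K \<and> y \<in> lin_span K V S \<and> w i = c \<odot>\<^bsub>V\<^esub> s \<oplus>\<^bsub>V\<^esub> y"
    for i
  proof -
    have "s \<in> carrier V" "S \<subseteq> carrier V" "w i \<in> lin_span K V (insert s S)" using insert.prems by auto
    then show ?thesis by (rule lin_span_insertE) auto
  qed
  then obtain c y where cy: "\<And>i. c i \<in> carrier K" "\<And>i. y i \<in> lin_span K V S"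
      "\<And>i. w i = c i \<odot>\<^bsub>V\<^esub> s \<oplus>\<^bsub>V\<^esub> y i" by metis
  have wV [simp]: "w i \<in> carrier V" for i
    using insert.prems lin_span_submodule[of "insert s S"] submodule_closed(1) by blast
  have S: "s \<in> carrier V" "S \<subseteq> carrier V" using insert.prems by auto
  have yV [simp]: "y i \<in> carrier V" for i using cy(2) sub[OF S(2)] submodule_closed(1) by blast
  note [simp] = S(1) cy(1)
  show ?case
  proof (cases "\<forall>i. c i = \<zero>")
    case True
    then have "w i \<in> lin_span K V S" for i using cy by simp
    then show ?thesis using insert.IH S by blast
  next
    case False
    then obtain m where m: "c m \<noteq> \<zero>" by blast
    define r where "r i = c i \<otimes> inv (c m)" for i
    define z where "z j = w (Suc m + j) \<ominus>\<^bsub>V\<^esub> r (Suc m + j) \<odot>\<^bsub>V\<^esub> w m" for j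
    have r [simp]: "r i \<in> carrier K" for i unfolding r_def using m by (simp add: field_Units)
    have rc: "r i \<otimes> c m = c i" for i
      unfolding r_def using m by (simp add: field_Units m_assoc)
    have w_z: "w (Suc m + j) = z j \<oplus>\<^bsub>V\<^esub> r (Suc m + j) \<odot>\<^bsub>V\<^esub> w m" for j
      unfolding z_def by (simp add: a_minus_def M.a_assoc M.l_neg)
    have "z j = y (Suc m + j) \<ominus>\<^bsub>V\<^esub> r (Suc m + j) \<odot>\<^bsub>V\<^esub> y m" for j
    proof -
      let ?i = "Suc m + j"
      have "r ?i \<odot>\<^bsub>V\<^esub> w m = c ?i \<odot>\<^bsub>V\<^esub> s \<oplus>\<^bsub>V\<^esub> r ?i \<odot>\<^bsub>V\<^esub> y m"
        by (simp add: cy(3)[of m] smult_r_distr smult_assoc1[symmetric] rc)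
      then show ?thesis unfolding z_def cy(3)[of ?i]
        by (simp add: M.minus_add_cancel_left)
    qed
    then have "z j \<in> lin_span K V S" for j
      using cy(2) by (simp add: submodule_closed(4,5)[OF sub[OF S(2)]])
    then obtain n where n: "z n \<in> lin_span K V (z ` {..<n})" using insert.IH[OF S(2)] by blast
    let ?n = "Suc m + n"
    let ?H = "lin_span K V (w ` {..<?n})"
    have H: "submodule ?H K V" by (rule lin_span_submodule) auto
    have wH: "w i \<in> ?H" if "i < ?n" for i using that by (intro lin_span_incl) auto
    have "z j \<in> ?H" if "j < n" for j
      unfolding z_def using that by (intro submodule_closed(4,5)[OF H] wH r) auto
    then have "lin_span K V (z ` {..<n}) \<subseteq> ?H" by (intro lin_span_least[OF H]) auto
    then have "w ?n \<in> ?H"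
      unfolding w_z using n by (intro submodule_closed(3,5)[OF H] wH r) auto
    then show ?thesis by blast
  qed
qed

section \<open>Eigenvectors over an algebraically closed field\<close>

text \<open>
  \<open>horner V T v [c\<^sub>n, \<dots>, c\<^sub>0]\<close> is \<open>p(T) v\<close> for the polynomial \<open>p = c\<^sub>n X\<^sup>n + \<dots> + c\<^sub>0\<close>, in the
  coefficient order of \<^const>\<open>ring.eval\<close>.
\<close>

definition horner :: "('k, 'a, 'n) module_scheme \<Rightarrow> ('a \<Rightarrow> 'a) \<Rightarrow> 'a \<Rightarrow> 'k list \<Rightarrow> 'a"
  where "horner V T v p = foldl (\<lambda>x c. T x \<oplus>\<^bsub>V\<^esub> c \<odot>\<^bsub>V\<^esub> v) \<zero>\<^bsub>V\<^esub> p"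

lemma horner_simps [simp]:
  "horner V T v [] = \<zero>\<^bsub>V\<^esub>"
  "horner V T v (p @ [c]) = T (horner V T v p) \<oplus>\<^bsub>V\<^esub> c \<odot>\<^bsub>V\<^esub> v"
  unfolding horner_def by auto

lemma (in module) lin_End_simps:
  assumes "T \<in> lin_End R M"
  shows "x \<in> carrier M \<Longrightarrow> T x \<in> carrier M"
    and "x \<in> carrier M \<Longrightarrow> y \<in> carrier M \<Longrightarrow> T (x \<oplus>\<^bsub>M\<^esub> y) = T x \<oplus>\<^bsub>M\<^esub> T y"
    and "a \<in> carrier R \<Longrightarrow> x \<in> carrier M \<Longrightarrow> T (a \<odot>\<^bsub>M\<^esub> x) = a \<odot>\<^bsub>M\<^esub> T x"
    and "T \<zero>\<^bsub>M\<^esub> = \<zero>\<^bsub>M\<^esub>"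
    and "x \<in> carrier M \<Longrightarrow> y \<in> carrier M \<Longrightarrow> T (x \<ominus>\<^bsub>M\<^esub> y) = T x \<ominus>\<^bsub>M\<^esub> T y"
proof -
  have cl: "T x \<in> carrier M" if "x \<in> carrier M" for x
    using assms that unfolding lin_End_def by auto
  have add: "T (x \<oplus>\<^bsub>M\<^esub> y) = T x \<oplus>\<^bsub>M\<^esub> T y" if "x \<in> carrier M" "y \<in> carrier M" for x y
    using assms that unfolding lin_End_def by auto
  have sm: "T (a \<odot>\<^bsub>M\<^esub> x) = a \<odot>\<^bsub>M\<^esub> T x" if "a \<in> carrier R" "x \<in> carrier M" for a x
    using assms that unfolding lin_End_def by auto
  have "T (\<zero>\<^bsub>R\<^esub> \<odot>\<^bsub>M\<^esub> \<zero>\<^bsub>M\<^esub>) = \<zero>\<^bsub>R\<^esub> \<odot>\<^bsub>M\<^esub> T \<zero>\<^bsub>M\<^esub>" by (rule sm) auto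
  then show "T \<zero>\<^bsub>M\<^esub> = \<zero>\<^bsub>M\<^esub>" by (simp add: cl)
  have neg: "T (\<ominus>\<^bsub>M\<^esub> y) = \<ominus>\<^bsub>M\<^esub> T y" if "y \<in> carrier M" for y
    using sm[of "\<ominus>\<^bsub>R\<^esub> \<one>\<^bsub>R\<^esub>" y] that by (simp add: smult_l_minus cl)
  show "T (x \<ominus>\<^bsub>M\<^esub> y) = T x \<ominus>\<^bsub>M\<^esub> T y" if "x \<in> carrier M" "y \<in> carrier M"
    using that by (simp add: a_minus_def add neg)
qed (use assms in \<open>auto simp: lin_End_def\<close>)

lemma (in linear_space) horner_in_submodule:
  assumes "submodule J K V" "\<And>x. x \<in> J \<Longrightarrow> T x \<in> J" "v \<in> J" "set p \<subseteq> carrier K"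
  shows "horner V T v p \<in> J"
  using assms(4)
proof (induction p rule: rev_induct)
  case (snoc c p)
  then show ?case using assms(2,3) by (simp add: submodule_closed[OF assms(1)])
qed (simp add: submodule_closed[OF assms(1)])

text \<open>
  Synthetic division by \<open>X - \<alpha>\<close>: the partial values of Horner's scheme for \<open>p(\<alpha>)\<close> are the
  coefficients of the quotient, and its last value is the remainder.
\<close>

lemma (in linear_space) synthetic_division:
  assumes T: "T \<in> lin_End K V" and v: "v \<in> carrier V" and a: "\<alpha> \<in> carrier K"
    and p: "set p \<subseteq> carrier K" "p \<noteq> []"
  shows "\<exists>q. set q \<subseteq> carrier K \<and> Suc (length q) = length p \<and> (q \<noteq> [] \<longrightarrow> hd q = hd p) \<and>
    horner V T v p = T (horner V T v q) \<ominus>\<^bsub>V\<^esub> \<alpha> \<odot>\<^bsub>V\<^esub> horner V T v q \<oplus>\<^bsub>V\<^esub> eval p \<alpha> \<odot>\<^bsub>V\<^esub> v"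
  using p
proof (induction p rule: rev_induct)
  case (snoc c p)
  note [simp] = v a lin_End_simps[OF T]
  have c [simp]: "c \<in> carrier K" and p: "set p \<subseteq> carrier K" using snoc.prems by auto
  have s [simp]: "eval p \<alpha> \<in> carrier K" using eval_in_carrier p a by blast
  have ev: "eval (p @ [c]) \<alpha> = eval p \<alpha> \<otimes> \<alpha> \<oplus> c" by (rule eval_append_aux[OF p c a])
  show ?case
  proof (cases "p = []")
    case True
    then show ?thesis by (intro exI[of _ "[]"]) (simp add: a_minus_def horner_def)
  next
    case False
    then obtain q where q: "set q \<subseteq> carrier K" "Suc (length q) = length p" "q \<noteq> [] \<Longrightarrow> hd q = hd p"
      "horner V T v p = T (horner V T v q) \<ominus>\<^bsub>V\<^esub> \<alpha> \<odot>\<^bsub>V\<^esub> horner V T v q \<oplus>\<^bsub>V\<^esub> eval p \<alpha> \<odot>\<^bsub>V\<^esub> v"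
      using snoc.IH p by blast
    let ?h = "horner V T v q"
    let ?s = "eval p \<alpha>"
    have h [simp]: "?h \<in> carrier V"
      by (rule horner_in_submodule[OF carrier_is_submodule]) (use q(1) in auto)
    have hd: "hd (q @ [?s]) = hd (p @ [c])"
    proof (cases "q = []")
      case True
      then obtain c0 where "p = [c0]" using q(2) by (cases p) auto
      then show ?thesis using True p by simp
    next
      case qne: False
      then show ?thesis using q(3) False by simp
    qed
    have "T (horner V T v p) \<oplus>\<^bsub>V\<^esub> c \<odot>\<^bsub>V\<^esub> v
        = T (T ?h) \<ominus>\<^bsub>V\<^esub> \<alpha> \<odot>\<^bsub>V\<^esub> T ?h \<oplus>\<^bsub>V\<^esub> ?s \<odot>\<^bsub>V\<^esub> T v \<oplus>\<^bsub>V\<^esub> c \<odot>\<^bsub>V\<^esub> v"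
      unfolding q(4) by simp
    also have "\<dots> = (T (T ?h) \<oplus>\<^bsub>V\<^esub> ?s \<odot>\<^bsub>V\<^esub> T v) \<ominus>\<^bsub>V\<^esub> (\<alpha> \<odot>\<^bsub>V\<^esub> T ?h \<oplus>\<^bsub>V\<^esub> (?s \<otimes> \<alpha>) \<odot>\<^bsub>V\<^esub> v)
        \<oplus>\<^bsub>V\<^esub> ((?s \<otimes> \<alpha>) \<odot>\<^bsub>V\<^esub> v \<oplus>\<^bsub>V\<^esub> c \<odot>\<^bsub>V\<^esub> v)"
      by (rule M.minus_add_regroup) auto
    also have "\<dots> = (T (T ?h) \<oplus>\<^bsub>V\<^esub> ?s \<odot>\<^bsub>V\<^esub> T v) \<ominus>\<^bsub>V\<^esub> \<alpha> \<odot>\<^bsub>V\<^esub> (T ?h \<oplus>\<^bsub>V\<^esub> ?s \<odot>\<^bsub>V\<^esub> v)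
        \<oplus>\<^bsub>V\<^esub> (?s \<otimes> \<alpha> \<oplus> c) \<odot>\<^bsub>V\<^esub> v"
      by (simp add: smult_r_distr smult_l_distr smult_assoc1[symmetric] m_comm[of \<alpha>])
    finally show ?thesis
      using q(1,2) hd by (intro exI[of _ "q @ [?s]"]) (simp add: ev)
  qed
qed simp

lemma (in field) ex_root:
  assumes "algebraically_closed R" "set p \<subseteq> carrier R" "length p \<ge> 2" "hd p \<noteq> \<zero>"
  shows "\<exists>\<alpha> \<in> carrier R. eval p \<alpha> = \<zero>"
proof -
  have p: "p \<in> carrier (poly_ring R)"
    using assms(2,4) by (simp add: univ_poly_carrier[symmetric] polynomial_def)
  then have "size (roots p) = length p - 1"
    using algebraically_closed.roots_over_carrier[OF assms(1)] by (simp add: splitted_def)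
  then have "roots p \<noteq> {#}" using assms(3) by force
  then obtain \<alpha> where "\<alpha> \<in># roots p" by blast
  then have "is_root p \<alpha>" using roots_mem_iff_is_root[OF p] by simp
  then show ?thesis unfolding is_root_def by blast
qed

text \<open>
  Split off a root \<open>\<alpha>\<close>: either the quotient does not annihilate \<open>v\<close>, and then its value at \<open>v\<close> is
  an eigenvector, or it does, and has smaller degree.
\<close>

lemma (in linear_space) eigenvector_of_annihilator:
  assumes "algebraically_closed K" and T: "T \<in> lin_End K V"
    and J: "submodule J K V" "\<And>x. x \<in> J \<Longrightarrow> T x \<in> J"
    and v: "v \<in> J" "v \<noteq> \<zero>\<^bsub>V\<^esub>"
    and p: "set p \<subseteq> carrier K" "p \<noteq> []" "hd p \<noteq> \<zero>" "horner V T v p = \<zero>\<^bsub>V\<^esub>"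
  shows "\<exists>x \<in> J. x \<noteq> \<zero>\<^bsub>V\<^esub> \<and> (\<exists>\<alpha> \<in> carrier K. T x = \<alpha> \<odot>\<^bsub>V\<^esub> x)"
  using p
proof (induction "length p" arbitrary: p rule: less_induct)
  case less
  note [simp] = lin_End_simps[OF T]
  have vV: "v \<in> carrier V" using submodule_closed(1)[OF J(1)] v by blast
  show ?case
  proof (cases "length p \<ge> 2")
    case False
    then obtain c where c: "p = [c]" using less.prems(2) by (cases p) (auto simp: not_le less_Suc_eq)
    then have cK: "c \<in> carrier K" "c \<noteq> \<zero>" using less.prems by auto
    have "c \<odot>\<^bsub>V\<^esub> v = \<zero>\<^bsub>V\<^esub>" using less.prems(4) vV cK c by (simp add: horner_def)
    then have "inv c \<odot>\<^bsub>V\<^esub> (c \<odot>\<^bsub>V\<^esub> v) = \<zero>\<^bsub>V\<^esub>" using cK by (simp add: field_Units)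
    then have "v = \<zero>\<^bsub>V\<^esub>" using cK vV by (simp add: smult_assoc1[symmetric] field_Units)
    then show ?thesis using v by blast
  next
    case True
    then obtain \<alpha> where a: "\<alpha> \<in> carrier K" "eval p \<alpha> = \<zero>"
      using ex_root assms(1) less.prems by blast
    obtain q where q: "set q \<subseteq> carrier K" "Suc (length q) = length p" "q \<noteq> [] \<Longrightarrow> hd q = hd p"
      "horner V T v p = T (horner V T v q) \<ominus>\<^bsub>V\<^esub> \<alpha> \<odot>\<^bsub>V\<^esub> horner V T v q \<oplus>\<^bsub>V\<^esub> eval p \<alpha> \<odot>\<^bsub>V\<^esub> v"
      using synthetic_division[OF T vV a(1) less.prems(1,2)] by blast
    let ?h = "horner V T v q"
    have hJ: "?h \<in> J" by (rule horner_in_submodule[OF J v(1) q(1)])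
    then have h [simp]: "?h \<in> carrier V" by (rule submodule_closed(1)[OF J(1)])
    have "T ?h \<ominus>\<^bsub>V\<^esub> \<alpha> \<odot>\<^bsub>V\<^esub> ?h = \<zero>\<^bsub>V\<^esub>" using q(4) less.prems(4) a vV by simp
    then have eig: "T ?h = \<alpha> \<odot>\<^bsub>V\<^esub> ?h" using a by (simp add: M.minus_eq_zero_iff)
    show ?thesis
    proof (cases "?h = \<zero>\<^bsub>V\<^esub>")
      case True
      have "q \<noteq> []" using q(2) \<open>length p \<ge> 2\<close> by auto
      then show ?thesis using less.hyps[of q] q less.prems True by auto
    next
      case False
      then show ?thesis using hJ eig a by blast
    qed
  qed
qed

text \<open>
  The values at \<open>v\<close> of the polynomials in \<open>T\<close> of degree less than \<open>n\<close>. The recursion follows Horner's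
  scheme, so that membership yields a coefficient list.
\<close>

primrec krylov :: "('k, 'm) ring_scheme \<Rightarrow> ('k, 'a, 'n) module_scheme \<Rightarrow> ('a \<Rightarrow> 'a) \<Rightarrow> 'a \<Rightarrow> nat \<Rightarrow> 'a set"
  where
    "krylov K V T v 0 = {\<zero>\<^bsub>V\<^esub>}"
  | "krylov K V T v (Suc n) =
      {T x \<oplus>\<^bsub>V\<^esub> c \<odot>\<^bsub>V\<^esub> v | x c. x \<in> krylov K V T v n \<and> c \<in> carrier K}"

lemma (in linear_space) krylov_submodule:
  assumes T: "T \<in> lin_End K V" and v: "v \<in> carrier V"
  shows "submodule (krylov K V T v n) K V"
proof (induction n)
  case 0
  then show ?case by (auto intro!: submoduleI_smult)
next
  case (Suc n)
  note [simp] = v lin_End_simps[OF T] submodule_closed[OF Suc.IH]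
  show ?case
  proof (rule submoduleI_smult)
    show "\<zero>\<^bsub>V\<^esub> \<in> krylov K V T v (Suc n)"
      by (auto intro!: exI[of _ "\<zero>\<^bsub>V\<^esub>"] exI[of _ "\<zero>"])
  next
    fix x y assume "x \<in> krylov K V T v (Suc n)" "y \<in> krylov K V T v (Suc n)"
    then obtain c u c' u' where cu: "c \<in> carrier K" "u \<in> krylov K V T v n" "c' \<in> carrier K"
        "u' \<in> krylov K V T v n" "x = T u \<oplus>\<^bsub>V\<^esub> c \<odot>\<^bsub>V\<^esub> v" "y = T u' \<oplus>\<^bsub>V\<^esub> c' \<odot>\<^bsub>V\<^esub> v" by auto
    then have "x \<oplus>\<^bsub>V\<^esub> y = T (u \<oplus>\<^bsub>V\<^esub> u') \<oplus>\<^bsub>V\<^esub> (c \<oplus> c') \<odot>\<^bsub>V\<^esub> v"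
      by (simp add: smult_l_distr M.a_ac)
    moreover have "u \<oplus>\<^bsub>V\<^esub> u' \<in> krylov K V T v n" "c \<oplus> c' \<in> carrier K" using cu by auto
    ultimately show "x \<oplus>\<^bsub>V\<^esub> y \<in> krylov K V T v (Suc n)" by auto
  next
    fix a x assume a: "a \<in> carrier K" and "x \<in> krylov K V T v (Suc n)"
    then obtain c u where cu: "c \<in> carrier K" "u \<in> krylov K V T v n" "x = T u \<oplus>\<^bsub>V\<^esub> c \<odot>\<^bsub>V\<^esub> v"
      by auto
    then have "a \<odot>\<^bsub>V\<^esub> x = T (a \<odot>\<^bsub>V\<^esub> u) \<oplus>\<^bsub>V\<^esub> (a \<otimes> c) \<odot>\<^bsub>V\<^esub> v"
      using a by (simp add: smult_r_distr smult_assoc1)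
    moreover have "a \<odot>\<^bsub>V\<^esub> u \<in> krylov K V T v n" "a \<otimes> c \<in> carrier K" using cu a by auto
    ultimately show "a \<odot>\<^bsub>V\<^esub> x \<in> krylov K V T v (Suc n)" by auto
  qed auto
qed

lemma (in linear_space) funpow_in_krylov:
  assumes T: "T \<in> lin_End K V" and v: "v \<in> carrier V" and "i < n"
  shows "(T ^^ i) v \<in> krylov K V T v n"
  using \<open>i < n\<close>
proof (induction n arbitrary: i)
  case (Suc n)
  note [simp] = v lin_End_simps[OF T] submodule_closed[OF krylov_submodule[OF T v]]
  show ?case
  proof (cases i)
    case 0
    then show ?thesis by (auto intro!: exI[of _ "\<zero>\<^bsub>V\<^esub>"] exI[of _ "\<one>"])
  next
    case (Suc j)
    then have "(T ^^ j) v \<in> krylov K V T v n" using Suc.IH Suc.prems by simp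
    then show ?thesis unfolding Suc
      by (auto intro!: exI[of _ "(T ^^ j) v"] exI[of _ "\<zero>"])
  qed
qed simp

text \<open>
  For \<open>x = - T\<^sup>n v\<close> the right-hand side vanishes, so a linear dependence among the iterates becomes an
  annihilating polynomial with leading coefficient \<open>1\<close>.
\<close>

lemma (in linear_space) monic_horner_of_krylov:
  assumes T: "T \<in> lin_End K V" and v: "v \<in> carrier V" and "x \<in> krylov K V T v n"
  shows "\<exists>p. set p \<subseteq> carrier K \<and> horner V T v (\<one> # p) = (T ^^ n) v \<oplus>\<^bsub>V\<^esub> x"
  using assms(3)
proof (induction n arbitrary: x)
  case 0
  then show ?case using v lin_End_simps[OF T] by (intro exI[of _ "[]"]) (simp add: horner_def)
next
  case (Suc n)
  note [simp] = v lin_End_simps[OF T] submodule_closed[OF krylov_submodule[OF T v]]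
  obtain y c where y: "y \<in> krylov K V T v n" "c \<in> carrier K" "x = T y \<oplus>\<^bsub>V\<^esub> c \<odot>\<^bsub>V\<^esub> v"
    using Suc.prems by auto
  obtain p where p: "set p \<subseteq> carrier K" "horner V T v (\<one> # p) = (T ^^ n) v \<oplus>\<^bsub>V\<^esub> y"
    using Suc.IH y(1) by blast
  have [simp]: "y \<in> carrier V" using y by simp
  have [simp]: "(T ^^ n) v \<in> carrier V" by (induction n) auto
  have "horner V T v (\<one> # (p @ [c])) = T (horner V T v (\<one> # p)) \<oplus>\<^bsub>V\<^esub> c \<odot>\<^bsub>V\<^esub> v"
    using horner_simps(2)[of V T v "\<one> # p" c] by simp
  also have "\<dots> = (T ^^ Suc n) v \<oplus>\<^bsub>V\<^esub> x" unfolding p y(3) using y(2) by (simp add: M.a_assoc)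
  finally show ?case using p(1) y(2) by (intro exI[of _ "p @ [c]"]) simp
qed

text \<open>
  In finite dimension some \<open>T\<^sup>n v\<close> depends linearly on the previous iterates, so a monic polynomial in
  \<open>T\<close> annihilates \<open>v\<close>.
\<close>

lemma (in linear_space) ex_eigenvector:
  assumes "algebraically_closed K" "fin_dim K V" and T: "T \<in> lin_End K V"
    and J: "submodule J K V" "\<And>x. x \<in> J \<Longrightarrow> T x \<in> J" "J \<noteq> {\<zero>\<^bsub>V\<^esub>}"
  shows "\<exists>x \<in> J. x \<noteq> \<zero>\<^bsub>V\<^esub> \<and> (\<exists>\<alpha> \<in> carrier K. T x = \<alpha> \<odot>\<^bsub>V\<^esub> x)"
proof -
  obtain v where v: "v \<in> J" "v \<noteq> \<zero>\<^bsub>V\<^esub>" using J(3) submodule_closed(2)[OF J(1)] by blast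
  have vV: "v \<in> carrier V" using submodule_closed(1)[OF J(1)] v by blast
  obtain S where S: "finite S" "S \<subseteq> carrier V" "lin_span K V S = carrier V"
    using assms(2) unfolding fin_dim_def by blast
  let ?w = "\<lambda>i. (T ^^ i) v"
  have w: "?w i \<in> carrier V" for i using vV lin_End_simps(1)[OF T] by (induction i) auto
  obtain n where n: "?w n \<in> lin_span K V (?w ` {..<n})"
    using sequence_dependent[OF S(1,2), of ?w] w S(3) by auto
  note K = krylov_submodule[OF T vV, of n]
  have "lin_span K V (?w ` {..<n}) \<subseteq> krylov K V T v n"
    using funpow_in_krylov[OF T vV] by (intro lin_span_least[OF K]) auto
  then have "\<ominus>\<^bsub>V\<^esub> ?w n \<in> krylov K V T v n" using n submoduleE(3)[OF K] by blast
  then obtain p where "set p \<subseteq> carrier K" "horner V T v (\<one> # p) = ?w n \<oplus>\<^bsub>V\<^esub> (\<ominus>\<^bsub>V\<^esub> ?w n)"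
    using monic_horner_of_krylov[OF T vV] by blast
  then show ?thesis
    using eigenvector_of_annihilator[OF assms(1) T J(1,2) v, of "\<one> # p"] w by (simp add: M.r_neg)
qed

text \<open>An eigenspace of one operator is invariant under all operators commuting with it.\<close>

lemma (in linear_space) ex_common_eigenvector:
  assumes "algebraically_closed K" "fin_dim K V" "finite S" "\<And>s. s \<in> S \<Longrightarrow> L s \<in> lin_End K V"
    and "\<And>s t x. s \<in> S \<Longrightarrow> t \<in> S \<Longrightarrow> x \<in> carrier V \<Longrightarrow> L s (L t x) = L t (L s x)"
    and "submodule J K V" "\<And>s x. s \<in> S \<Longrightarrow> x \<in> J \<Longrightarrow> L s x \<in> J" "J \<noteq> {\<zero>\<^bsub>V\<^esub>}"
  shows "\<exists>x \<in> J. x \<noteq> \<zero>\<^bsub>V\<^esub> \<and> (\<forall>s \<in> S. \<exists>\<alpha> \<in> carrier K. L s x = \<alpha> \<odot>\<^bsub>V\<^esub> x)"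
  using assms(3-8)
proof (induction S arbitrary: J rule: finite_induct)
  case empty
  then show ?case using submodule_closed(2)[OF empty(3)] by blast
next
  case (insert s S)
  have Ls: "L s \<in> lin_End K V" using insert.prems by blast
  note [simp] = submodule_closed[OF insert.prems(3)] lin_End_simps[OF Ls]
  obtain x \<alpha> where x: "x \<in> J" "x \<noteq> \<zero>\<^bsub>V\<^esub>" "\<alpha> \<in> carrier K" "L s x = \<alpha> \<odot>\<^bsub>V\<^esub> x"
    using ex_eigenvector[OF assms(1,2) Ls insert.prems(3) _ insert.prems(5)] insert.prems(4)
    by blast
  let ?J = "{x \<in> J. L s x = \<alpha> \<odot>\<^bsub>V\<^esub> x}"
  have "submodule ?J K V"
  proof (rule submoduleI_smult)
    fix a y assume "a \<in> carrier K" "y \<in> ?J"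
    then show "a \<odot>\<^bsub>V\<^esub> y \<in> ?J" using x(3)
      by (simp add: smult_assoc1[symmetric] m_comm)
  qed (use x(3) in \<open>auto simp: smult_r_distr\<close>)
  moreover have "L t y \<in> ?J" if "t \<in> S" "y \<in> ?J" for t y
  proof -
    have Lt: "L t \<in> lin_End K V" using insert.prems that by blast
    have "L s (L t y) = L t (L s y)" using insert.prems(2)[of s t y] that by auto
    then show ?thesis using that x(3) insert.prems(4)[of t y] by (simp add: lin_End_simps[OF Lt])
  qed
  moreover have "?J \<noteq> {\<zero>\<^bsub>V\<^esub>}" using x by blast
  ultimately obtain y where "y \<in> ?J" "y \<noteq> \<zero>\<^bsub>V\<^esub>" "\<forall>s \<in> S. \<exists>\<alpha> \<in> carrier K. L s y = \<alpha> \<odot>\<^bsub>V\<^esub> y"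
    using insert.IH[of ?J] insert.prems(1,2) by blast
  then show ?case using x(3) by blast
qed

section \<open>Images, subalgebras and quotients of algebras\<close>

sublocale fd_algebra \<subseteq> linear_space K A ..

lemma (in module) fin_dim_image:
  assumes fd: "fin_dim R M" and N: "module R N" and surj: "f ` carrier M = carrier N"
    and add: "\<And>x y. x \<in> carrier M \<Longrightarrow> y \<in> carrier M \<Longrightarrow> f (x \<oplus>\<^bsub>M\<^esub> y) = f x \<oplus>\<^bsub>N\<^esub> f y"
    and smult: "\<And>a x. a \<in> carrier R \<Longrightarrow> x \<in> carrier M \<Longrightarrow> f (a \<odot>\<^bsub>M\<^esub> x) = a \<odot>\<^bsub>N\<^esub> f x"
  shows "fin_dim R N"
proof -
  interpret N: module R N by fact
  obtain S where S: "finite S" "S \<subseteq> carrier M" "lin_span R M S = carrier M"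
    using fd unfolding fin_dim_def by blast
  have fS: "f ` S \<subseteq> carrier N" using S surj by blast
  note sub = N.submodule_closed[OF N.lin_span_submodule[OF fS]]
  have fN: "f x \<in> carrier N" if "x \<in> carrier M" for x using surj that by blast
  let ?H = "{x \<in> carrier M. f x \<in> lin_span R N (f ` S)}"
  have "f (\<zero>\<^bsub>R\<^esub> \<odot>\<^bsub>M\<^esub> \<zero>\<^bsub>M\<^esub>) = \<zero>\<^bsub>R\<^esub> \<odot>\<^bsub>N\<^esub> f \<zero>\<^bsub>M\<^esub>" by (rule smult) auto
  then have "f \<zero>\<^bsub>M\<^esub> = \<zero>\<^bsub>N\<^esub>" by (simp add: fN)
  then have "submodule ?H R M"
    by (intro submoduleI_smult) (auto simp: add smult intro: sub)
  then have "lin_span R M S \<subseteq> ?H" by (rule lin_span_least) (use S(2) in \<open>auto intro: lin_span_incl\<close>)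
  then have "f x \<in> lin_span R N (f ` S)" if "x \<in> carrier M" for x
    using that unfolding S(3) by (auto dest: subsetD)
  then have "carrier N \<subseteq> lin_span R N (f ` S)" unfolding surj[symmetric] by (rule image_subsetI)
  then have "lin_span R N (f ` S) = carrier N"
    by (intro equalityI subsetI) (erule sub(1), erule subsetD)
  then show ?thesis unfolding fin_dim_def using S(1) fS by blast
qed

text \<open>
  \<open>Q\<close> is only assumed to carry operations. It satisfies the axioms of an algebra because \<open>\<pi>\<close> maps onto
  it and respects the operations; for a quotient this leaves just the coset map to be examined.
\<close>

locale surjective_alg_hom = fd_algebra K A for K (structure) and A (structure) +
  fixes Q (structure) and \<pi>
  assumes surj: "\<pi> ` carrier A = carrier Q"
    and hom_zero: "\<pi> \<zero>\<^bsub>A\<^esub> = \<zero>\<^bsub>Q\<^esub>"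
    and hom_add: "\<lbrakk>x \<in> carrier A; y \<in> carrier A\<rbrakk> \<Longrightarrow> \<pi> (x \<oplus>\<^bsub>A\<^esub> y) = \<pi> x \<oplus>\<^bsub>Q\<^esub> \<pi> y"
    and hom_smult: "\<lbrakk>a \<in> carrier K; x \<in> carrier A\<rbrakk> \<Longrightarrow> \<pi> (a \<odot>\<^bsub>A\<^esub> x) = a \<odot>\<^bsub>Q\<^esub> \<pi> x"
    and hom_mult: "\<lbrakk>x \<in> carrier A; y \<in> carrier A\<rbrakk> \<Longrightarrow> \<pi> (x \<otimes>\<^bsub>A\<^esub> y) = \<pi> x \<otimes>\<^bsub>Q\<^esub> \<pi> y"
begin

lemma hom_closed: "x \<in> carrier A \<Longrightarrow> \<pi> x \<in> carrier Q"
  using surj by blast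

lemma preimageE:
  assumes "z \<in> carrier Q" obtains x where "x \<in> carrier A" "z = \<pi> x"
  using assms surj by blast

lemmas push = hom_zero[symmetric] hom_add[symmetric] hom_smult[symmetric] hom_mult[symmetric]

lemma image_fd_algebra: "fd_algebra K Q"
proof -
  have grp: "abelian_group Q"
  proof (rule abelian_groupI)
    fix x assume "x \<in> carrier Q"
    then obtain u where u: "u \<in> carrier A" "x = \<pi> u" by (rule preimageE)
    then show "\<exists>y \<in> carrier Q. y \<oplus>\<^bsub>Q\<^esub> x = \<zero>\<^bsub>Q\<^esub>"
      by (intro bexI[of _ "\<pi> (\<ominus>\<^bsub>A\<^esub> u)"]) (simp_all add: push M.l_neg hom_closed)
  qed (auto elim!: preimageE simp: push hom_closed M.a_ac)
  have Q: "module K Q"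
    by (rule moduleI[OF _ grp])
      (auto elim!: preimageE simp: push hom_closed smult_l_distr smult_r_distr smult_assoc1
        is_cring)
  have "fin_dim K Q" using surj hom_add hom_smult by (intro fin_dim_image[OF fin_dim Q, of \<pi>])
  then show ?thesis
    by (intro fd_algebra.intro fd_algebra_axioms.intro Q field_axioms)
      (auto elim!: preimageE simp: push hom_closed prod_closed prod_add_left prod_add_right
        prod_smult_left prod_smult_right)
qed

lemma hom_minus:
  assumes "x \<in> carrier A" "y \<in> carrier A"
  shows "\<pi> (x \<ominus>\<^bsub>A\<^esub> y) = \<pi> x \<ominus>\<^bsub>Q\<^esub> \<pi> y"
proof -
  interpret Q: fd_algebra K Q by (rule image_fd_algebra)
  have "\<pi> (\<ominus>\<^bsub>A\<^esub> y) = \<pi> ((\<ominus> \<one>) \<odot>\<^bsub>A\<^esub> y)" using assms smult_l_minus[of \<one> y] by simp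
  also have "\<dots> = \<ominus>\<^bsub>Q\<^esub> \<pi> y" using assms hom_smult[of "\<ominus> \<one>" y] Q.smult_l_minus[of \<one> "\<pi> y"]
    by (simp add: hom_closed)
  finally show ?thesis using assms by (simp add: a_minus_def hom_add)
qed

end

lemma fd_subalgebra:
  fixes A :: "('k, 'a) module"
  assumes "fd_algebra K A" "submodule H K A" "\<And>x y. x \<in> H \<Longrightarrow> y \<in> H \<Longrightarrow> x \<otimes>\<^bsub>A\<^esub> y \<in> H"
    and "fin_dim K (subalg A H)"
  shows "fd_algebra K (subalg A H)"
proof -
  interpret fd_algebra K A by fact
  have "module K (subalg A H)"
    unfolding subalg_def by (rule submodule.submodule_is_module[OF assms(2)]) unfold_locales
  moreover have "H \<subseteq> carrier A" using submodule_closed(1)[OF assms(2)] by blast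
  ultimately show ?thesis using assms(3,4)
    by (intro fd_algebra.intro fd_algebra_axioms.intro field_axioms)
      (auto simp: subalg_def prod_add_left prod_add_right prod_smult_left prod_smult_right subset_iff)
qed

locale quotient_algebra = fd_algebra K A
  for K (structure) and A :: "('a, 'c) module" (structure) +
  fixes I :: "'c set"
  assumes ideal: "two_sided_ideal K A I"
begin

abbreviation coset :: "'c \<Rightarrow> 'c set"
  where "coset \<equiv> a_r_coset A I"

lemma ideal_submodule: "submodule I K A"
  using ideal unfolding two_sided_ideal_def by blast

lemmas ideal_closed = submodule_closed[OF ideal_submodule]

lemma ideal_mult:
  assumes "x \<in> I" "u \<in> carrier A" shows "u \<otimes>\<^bsub>A\<^esub> x \<in> I" "x \<otimes>\<^bsub>A\<^esub> u \<in> I"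
  using assms ideal unfolding two_sided_ideal_def by blast+

lemma ideal_abelian_subgroup: "abelian_subgroup I A"
  using submodule.axioms(1)[OF ideal_submodule]
  by (intro abelian_subgroupI3 additive_subgroup.intro M.abelian_group_axioms)

lemma mem_coset_iff:
  assumes "x \<in> carrier A"
  shows "y \<in> coset x \<longleftrightarrow> y \<in> carrier A \<and> y \<ominus>\<^bsub>A\<^esub> x \<in> I"
proof -
  interpret S: abelian_subgroup I A by (rule ideal_abelian_subgroup)
  have "y \<in> carrier A" if "y \<in> coset x"
    using that assms ideal_closed(1) by (auto simp: a_r_coset_def')
  then show ?thesis using S.a_rcos_module[OF assms] by (auto simp: a_minus_def)
qed

lemma coset_eq_iff:
  assumes "x \<in> carrier A" "y \<in> carrier A"
  shows "coset x = coset y \<longleftrightarrow> x \<ominus>\<^bsub>A\<^esub> y \<in> I"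
proof -
  interpret S: abelian_subgroup I A by (rule ideal_abelian_subgroup)
  show ?thesis
  proof
    assume "coset x = coset y"
    then have "x \<in> coset y" using S.a_rcos_self assms by blast
    then show "x \<ominus>\<^bsub>A\<^esub> y \<in> I" using assms by (simp add: mem_coset_iff)
  next
    assume "x \<ominus>\<^bsub>A\<^esub> y \<in> I"
    then have "x \<in> coset y" using assms by (simp add: mem_coset_iff)
    then show "coset x = coset y"
      using M.a_repr_independence[OF _ assms(2) S.a_subgroup] by simp
  qed
qed

lemma self_in_coset: "x \<in> carrier A \<Longrightarrow> x \<in> coset x"
  by (simp add: mem_coset_iff M.minus_eq_zero_iff[THEN iffD2] ideal_closed)

lemma mult_coset_well_defined:
  assumes "x \<in> carrier A" "y \<in> carrier A" "u \<in> coset x" "v \<in> coset y"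
  shows "coset (u \<otimes>\<^bsub>A\<^esub> v) = coset (x \<otimes>\<^bsub>A\<^esub> y)"
proof -
  have uv: "u \<in> carrier A" "v \<in> carrier A" "u \<ominus>\<^bsub>A\<^esub> x \<in> I" "v \<ominus>\<^bsub>A\<^esub> y \<in> I"
    using assms by (simp_all add: mem_coset_iff)
  have u: "u = (u \<ominus>\<^bsub>A\<^esub> x) \<oplus>\<^bsub>A\<^esub> x" and v: "v = (v \<ominus>\<^bsub>A\<^esub> y) \<oplus>\<^bsub>A\<^esub> y"
    using uv assms by (simp_all add: a_minus_def M.a_assoc M.l_neg)
  have "u \<otimes>\<^bsub>A\<^esub> v = (u \<ominus>\<^bsub>A\<^esub> x) \<otimes>\<^bsub>A\<^esub> v \<oplus>\<^bsub>A\<^esub> (x \<otimes>\<^bsub>A\<^esub> (v \<ominus>\<^bsub>A\<^esub> y) \<oplus>\<^bsub>A\<^esub> x \<otimes>\<^bsub>A\<^esub> y)"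
    using uv assms prod_add_left[of "u \<ominus>\<^bsub>A\<^esub> x" x v] prod_add_right[of x "v \<ominus>\<^bsub>A\<^esub> y" y] u v by simp
  then have "u \<otimes>\<^bsub>A\<^esub> v \<ominus>\<^bsub>A\<^esub> x \<otimes>\<^bsub>A\<^esub> y = (u \<ominus>\<^bsub>A\<^esub> x) \<otimes>\<^bsub>A\<^esub> v \<oplus>\<^bsub>A\<^esub> x \<otimes>\<^bsub>A\<^esub> (v \<ominus>\<^bsub>A\<^esub> y)"
    using uv assms by (simp add: a_minus_def M.a_assoc M.r_neg prod_closed)
  also have "\<dots> \<in> I" using uv assms by (intro ideal_closed(3) ideal_mult) auto
  finally show ?thesis using uv assms by (simp add: coset_eq_iff prod_closed)
qed

lemma coset_hom: "surjective_alg_hom K A (quot_alg A I) coset"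
proof -
  interpret S: abelian_subgroup I A by (rule ideal_abelian_subgroup)
  show ?thesis
  proof unfold_locales
    show "coset ` carrier A = carrier (quot_alg A I)"
      by (auto simp: quot_alg_def FactRing_def A_RCOSETS_def')
    show "coset \<zero>\<^bsub>A\<^esub> = \<zero>\<^bsub>quot_alg A I\<^esub>"
      using ideal_closed(1) by (auto simp: quot_alg_def FactRing_def intro!: M.a_coset_add_zero)
  next
    fix x y assume xy: "x \<in> carrier A" "y \<in> carrier A"
    show "coset (x \<oplus>\<^bsub>A\<^esub> y) = coset x \<oplus>\<^bsub>quot_alg A I\<^esub> coset y"
      using S.a_rcos_sum[OF xy] by (simp add: quot_alg_def FactRing_def)
    have "rcoset_mult A I (coset x) (coset y) = coset (x \<otimes>\<^bsub>A\<^esub> y)"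
    proof -
      have "rcoset_mult A I (coset x) (coset y) = (\<Union>u \<in> coset x. \<Union>v \<in> coset y. coset (x \<otimes>\<^bsub>A\<^esub> y))"
        unfolding rcoset_mult_def using mult_coset_well_defined[OF xy] by auto
      then show ?thesis using self_in_coset xy by blast
    qed
    then show "coset (x \<otimes>\<^bsub>A\<^esub> y) = coset x \<otimes>\<^bsub>quot_alg A I\<^esub> coset y"
      by (simp add: quot_alg_def FactRing_def)
  next
    fix a x assume a: "a \<in> carrier K" and x: "x \<in> carrier A"
    have "I <+>\<^bsub>A\<^esub> ((\<lambda>x. a \<odot>\<^bsub>A\<^esub> x) ` coset x) = coset (a \<odot>\<^bsub>A\<^esub> x)"
    proof
      show "I <+>\<^bsub>A\<^esub> ((\<lambda>x. a \<odot>\<^bsub>A\<^esub> x) ` coset x) \<subseteq> coset (a \<odot>\<^bsub>A\<^esub> x)"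
      proof
        fix z assume "z \<in> I <+>\<^bsub>A\<^esub> ((\<lambda>x. a \<odot>\<^bsub>A\<^esub> x) ` coset x)"
        then obtain h y where h: "h \<in> I" "y \<in> coset x" "z = h \<oplus>\<^bsub>A\<^esub> a \<odot>\<^bsub>A\<^esub> y"
          by (auto simp: set_add_def set_mult_def)
        have hA [simp]: "h \<in> carrier A" using h ideal_closed by blast
        have y: "y \<in> carrier A" "y \<ominus>\<^bsub>A\<^esub> x \<in> I" using h(2) x by (simp_all add: mem_coset_iff)
        have "z \<ominus>\<^bsub>A\<^esub> a \<odot>\<^bsub>A\<^esub> x = h \<oplus>\<^bsub>A\<^esub> a \<odot>\<^bsub>A\<^esub> (y \<ominus>\<^bsub>A\<^esub> x)"
          using h y(1) x a by (simp add: a_minus_def M.a_assoc smult_r_distr smult_r_minus)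
        moreover have "h \<oplus>\<^bsub>A\<^esub> a \<odot>\<^bsub>A\<^esub> (y \<ominus>\<^bsub>A\<^esub> x) \<in> I" using h(1) a y(2) by (intro ideal_closed(3,5))
        ultimately show "z \<in> coset (a \<odot>\<^bsub>A\<^esub> x)"
          using h(3) y(1) x a by (simp add: mem_coset_iff)
      qed
      show "coset (a \<odot>\<^bsub>A\<^esub> x) \<subseteq> I <+>\<^bsub>A\<^esub> ((\<lambda>x. a \<odot>\<^bsub>A\<^esub> x) ` coset x)"
      proof
        fix z assume "z \<in> coset (a \<odot>\<^bsub>A\<^esub> x)"
        then obtain h where "h \<in> I" "z = h \<oplus>\<^bsub>A\<^esub> a \<odot>\<^bsub>A\<^esub> x"
          unfolding a_r_coset_def' by blast
        moreover have "a \<odot>\<^bsub>A\<^esub> x \<in> (\<lambda>x. a \<odot>\<^bsub>A\<^esub> x) ` coset x"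
          using self_in_coset[OF x] by (rule imageI)
        ultimately show "z \<in> I <+>\<^bsub>A\<^esub> ((\<lambda>x. a \<odot>\<^bsub>A\<^esub> x) ` coset x)"
          unfolding set_add_def set_mult_def by force
      qed
    qed
    then show "coset (a \<odot>\<^bsub>A\<^esub> x) = a \<odot>\<^bsub>quot_alg A I\<^esub> coset x"
      by (simp add: quot_alg_def)
  qed
qed

end

section \<open>Symplectic reduction\<close>

lemma (in presymplectic_lsa) form_minus:
  assumes "x \<in> carrier A" "y \<in> carrier A" "z \<in> carrier A"
  shows "\<omega> (x \<ominus>\<^bsub>A\<^esub> y) z = \<omega> x z \<ominus> \<omega> y z" "\<omega> z (x \<ominus>\<^bsub>A\<^esub> y) = \<omega> z x \<ominus> \<omega> z y"
proof -
  have y: "\<ominus>\<^bsub>A\<^esub> y = (\<ominus> \<one>) \<odot>\<^bsub>A\<^esub> y" using assms smult_l_minus[of \<one> y] by simp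
  have "\<omega> (\<ominus>\<^bsub>A\<^esub> y) z = \<ominus> \<omega> y z" "\<omega> z (\<ominus>\<^bsub>A\<^esub> y) = \<ominus> \<omega> z y"
    unfolding y using assms by (simp_all add: form_smult_left form_smult_right form_closed l_minus)
  then show "\<omega> (x \<ominus>\<^bsub>A\<^esub> y) z = \<omega> x z \<ominus> \<omega> y z" "\<omega> z (x \<ominus>\<^bsub>A\<^esub> y) = \<omega> z x \<ominus> \<omega> z y"
    using assms
    by (simp_all add: a_minus_def form_add_left form_add_right)
qed

text \<open>
  \<open>H\<close> is a subalgebra whose radical \<open>I = H \<inter> H\<^sup>\<perp>\<close> is an ideal of it, so that product and form descend
  to \<open>H/I\<close>, where the form becomes nondegenerate.
\<close>

locale reduction = presymplectic_lsa K A \<omega>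
  for K (structure) and A :: "('a, 'c) module" (structure) and \<omega> +
  fixes H I :: "'c set"
  assumes sub: "submodule H K A"
    and sub_mult: "\<lbrakk>x \<in> H; y \<in> H\<rbrakk> \<Longrightarrow> x \<otimes>\<^bsub>A\<^esub> y \<in> H"
    and sub_fin_dim: "fin_dim K (subalg A H)"
    and radical_ideal: "two_sided_ideal K (subalg A H) I"
    and radical: "x \<in> H \<Longrightarrow> x \<in> I \<longleftrightarrow> (\<forall>y \<in> H. \<omega> x y = \<zero>)"
begin

lemmas sub_closed = submodule_closed[OF sub]

sublocale H: fd_algebra K "subalg A H"
  using fd_algebra_axioms sub sub_mult sub_fin_dim by (rule fd_subalgebra)

sublocale HI: quotient_algebra K "subalg A H" I
  by unfold_locales (rule radical_ideal)

sublocale HI: surjective_alg_hom K "subalg A H" "quot_alg (subalg A H) I" "HI.coset"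
  by (rule HI.coset_hom)

abbreviation "B \<equiv> quot_alg (subalg A H) I"

abbreviation "\<omega>\<^sub>B \<equiv> quot_form \<omega>"

sublocale B: fd_algebra K B
  by (rule HI.image_fd_algebra)

lemma subalg_simps [simp]:
  "carrier (subalg A H) = H" "\<zero>\<^bsub>subalg A H\<^esub> = \<zero>\<^bsub>A\<^esub>" "x \<oplus>\<^bsub>subalg A H\<^esub> y = x \<oplus>\<^bsub>A\<^esub> y"
  "x \<otimes>\<^bsub>subalg A H\<^esub> y = x \<otimes>\<^bsub>A\<^esub> y" "a \<odot>\<^bsub>subalg A H\<^esub> x = a \<odot>\<^bsub>A\<^esub> x"
  by (simp_all add: subalg_def)

lemma subalg_minus [simp]:
  assumes "x \<in> H" "y \<in> H" shows "x \<ominus>\<^bsub>subalg A H\<^esub> y = x \<ominus>\<^bsub>A\<^esub> y"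
proof -
  have "x \<ominus>\<^bsub>subalg A H\<^esub> y = x \<oplus>\<^bsub>A\<^esub> (\<ominus> \<one>) \<odot>\<^bsub>A\<^esub> y"
    using assms H.smult_l_minus[of \<one> y] H.smult_one[of y] by (simp add: a_minus_def)
  also have "\<dots> = x \<ominus>\<^bsub>A\<^esub> y"
    using assms sub_closed(1) smult_l_minus[of \<one> y] by (simp add: a_minus_def)
  finally show ?thesis .
qed

lemmas coset_zero = HI.hom_zero[simplified]
  and coset_add = HI.hom_add[simplified]
  and coset_smult = HI.hom_smult[simplified]
  and coset_mult = HI.hom_mult[simplified]
  and coset_closed = HI.hom_closed[simplified]
  and cosetE = HI.preimageE[simplified]

lemma coset_minus:
  "\<lbrakk>x \<in> H; y \<in> H\<rbrakk> \<Longrightarrow> HI.coset (x \<ominus>\<^bsub>A\<^esub> y) = HI.coset x \<ominus>\<^bsub>B\<^esub> HI.coset y"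
  using HI.hom_minus[of x y] by simp

lemma coset_eq_iff: "\<lbrakk>x \<in> H; y \<in> H\<rbrakk> \<Longrightarrow> HI.coset x = HI.coset y \<longleftrightarrow> x \<ominus>\<^bsub>A\<^esub> y \<in> I"
  using HI.coset_eq_iff[of x y] by simp

lemma quot_form_coset:
  assumes "x \<in> H" "y \<in> H"
  shows "\<omega>\<^sub>B (HI.coset x) (HI.coset y) = \<omega> x y"
proof -
  have wd: "\<omega> u v = \<omega> x y" if u: "u \<in> HI.coset x" and v: "v \<in> HI.coset y" for u v
  proof -
    have uv: "u \<in> H" "v \<in> H" "u \<ominus>\<^bsub>A\<^esub> x \<in> I" "v \<ominus>\<^bsub>A\<^esub> y \<in> I"
      using u v assms HI.mem_coset_iff by auto
    note A = sub_closed(1)[OF uv(1)] sub_closed(1)[OF uv(2)] sub_closed(1)[OF assms(1)]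
      sub_closed(1)[OF assms(2)]
    have "\<omega> (u \<ominus>\<^bsub>A\<^esub> x) v = \<zero>" using radical uv assms by (simp add: sub_closed)
    then have 1: "\<omega> u v = \<omega> x v" using A by (simp add: form_minus form_closed)
    have "\<omega> (v \<ominus>\<^bsub>A\<^esub> y) x = \<zero>" using radical uv assms by (simp add: sub_closed)
    then have "\<omega> v x = \<omega> y x" using A by (simp add: form_minus form_closed)
    then have "\<omega> x v = \<omega> x y" using A form_skew[of x v] form_skew[of x y] by simp
    then show ?thesis using 1 by simp
  qed
  show ?thesis unfolding quot_form_def
  proof (rule the_equality)
    have "x \<in> HI.coset x" "y \<in> HI.coset y" using HI.self_in_coset assms by simp_all
    then show "\<exists>u \<in> HI.coset x. \<exists>v \<in> HI.coset y. \<omega> x y = \<omega> u v" by blast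
  next
    fix c assume "\<exists>u \<in> HI.coset x. \<exists>v \<in> HI.coset y. c = \<omega> u v"
    then obtain u v where "u \<in> HI.coset x" "v \<in> HI.coset y" "c = \<omega> u v" by blast
    then show "c = \<omega> x y" using wd by simp
  qed
qed

sublocale B: presymplectic_lsa K B "\<omega>\<^sub>B"
proof unfold_locales
  note [simp] = coset_closed coset_zero[symmetric] coset_add[symmetric] coset_smult[symmetric]
    coset_mult[symmetric] coset_minus[symmetric] quot_form_coset sub_closed sub_mult
  fix u v w
  show "(u \<otimes>\<^bsub>B\<^esub> v) \<otimes>\<^bsub>B\<^esub> w \<ominus>\<^bsub>B\<^esub> u \<otimes>\<^bsub>B\<^esub> (v \<otimes>\<^bsub>B\<^esub> w)
      = (v \<otimes>\<^bsub>B\<^esub> u) \<otimes>\<^bsub>B\<^esub> w \<ominus>\<^bsub>B\<^esub> v \<otimes>\<^bsub>B\<^esub> (u \<otimes>\<^bsub>B\<^esub> w)"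
    if mem: "u \<in> carrier B" "v \<in> carrier B" "w \<in> carrier B"
  proof -
    obtain x where x: "x \<in> H" "u = HI.coset x" using mem(1) by (rule cosetE)
    obtain y where y: "y \<in> H" "v = HI.coset y" using mem(2) by (rule cosetE)
    obtain z where z: "z \<in> H" "w = HI.coset z" using mem(3) by (rule cosetE)
    from x y z show ?thesis using left_symmetric[of x y z] by simp
  qed
  show "\<omega>\<^sub>B u v \<in> carrier K" if "u \<in> carrier B" "v \<in> carrier B"
    using that form_closed by (auto elim!: cosetE)
  show "\<omega>\<^sub>B (u \<oplus>\<^bsub>B\<^esub> v) w = \<omega>\<^sub>B u w \<oplus> \<omega>\<^sub>B v w" "\<omega>\<^sub>B u (v \<oplus>\<^bsub>B\<^esub> w) = \<omega>\<^sub>B u v \<oplus> \<omega>\<^sub>B u w"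
      "\<omega>\<^sub>B (u \<otimes>\<^bsub>B\<^esub> v) w = \<omega>\<^sub>B v (u \<otimes>\<^bsub>B\<^esub> w)"
    if mem: "u \<in> carrier B" "v \<in> carrier B" "w \<in> carrier B"
  proof -
    obtain x where x: "x \<in> H" "u = HI.coset x" using mem(1) by (rule cosetE)
    obtain y where y: "y \<in> H" "v = HI.coset y" using mem(2) by (rule cosetE)
    obtain z where z: "z \<in> H" "w = HI.coset z" using mem(3) by (rule cosetE)
    from x y z show "\<omega>\<^sub>B (u \<oplus>\<^bsub>B\<^esub> v) w = \<omega>\<^sub>B u w \<oplus> \<omega>\<^sub>B v w" "\<omega>\<^sub>B u (v \<oplus>\<^bsub>B\<^esub> w) = \<omega>\<^sub>B u v \<oplus> \<omega>\<^sub>B u w"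
      "\<omega>\<^sub>B (u \<otimes>\<^bsub>B\<^esub> v) w = \<omega>\<^sub>B v (u \<otimes>\<^bsub>B\<^esub> w)"
      using form_add_left[of x y z] form_add_right[of x y z] form_compatible[of x y z] by simp_all
  qed
  show "\<omega>\<^sub>B u v = \<ominus> \<omega>\<^sub>B v u" if mem: "u \<in> carrier B" "v \<in> carrier B"
  proof -
    obtain x where x: "x \<in> H" "u = HI.coset x" using mem(1) by (rule cosetE)
    obtain y where y: "y \<in> H" "v = HI.coset y" using mem(2) by (rule cosetE)
    from x y show ?thesis using form_skew[of x y] by simp
  qed
  show "u = \<zero>\<^bsub>B\<^esub>" if u: "u \<in> carrier B" and orth: "\<And>v. v \<in> carrier B \<Longrightarrow> \<omega>\<^sub>B u v = \<zero>"
  proof -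
    obtain x where x: "x \<in> H" "u = HI.coset x" using u by (rule cosetE)
    have "\<omega> x y = \<zero>" if "y \<in> H" for y using orth[of "HI.coset y"] that x by simp
    then have "x \<in> I" using radical x by blast
    then show ?thesis using x coset_eq_iff[of x "\<zero>\<^bsub>A\<^esub>"] sub_closed(1)[OF x(1)]
      by (simp add: M.minus_zero_right)
  qed
next
  note [simp] = coset_closed coset_smult[symmetric] quot_form_coset sub_closed
  fix a u v
  show "\<omega>\<^sub>B (a \<odot>\<^bsub>B\<^esub> u) v = a \<otimes> \<omega>\<^sub>B u v" "\<omega>\<^sub>B u (a \<odot>\<^bsub>B\<^esub> v) = a \<otimes> \<omega>\<^sub>B u v"
    if "a \<in> carrier K" "u \<in> carrier B" "v \<in> carrier B"
    using that form_smult_left form_smult_right by (auto elim!: cosetE)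
qed

text \<open>
  The endomorphism of \<open>H/I\<close> induced by \<open>T\<close>. The choice of the representative is immaterial when \<open>T\<close>
  leaves \<open>H\<close> and \<open>I\<close> invariant.
\<close>

definition induced :: "('c \<Rightarrow> 'c) \<Rightarrow> 'c set \<Rightarrow> 'c set"
  where "induced T S = HI.coset (T (SOME x. x \<in> H \<and> HI.coset x = S))"

lemma induced_coset:
  assumes T: "T \<in> lin_End K A" "\<And>x. x \<in> H \<Longrightarrow> T x \<in> H" "\<And>x. x \<in> I \<Longrightarrow> T x \<in> I"
    and x: "x \<in> H"
  shows "induced T (HI.coset x) = HI.coset (T x)"
proof -
  define y where "y = (SOME y. y \<in> H \<and> HI.coset y = HI.coset x)"
  have "y \<in> H \<and> HI.coset y = HI.coset x"
    unfolding y_def by (rule someI[of _ x]) (use x in simp)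
  then have y: "y \<in> H" "y \<ominus>\<^bsub>A\<^esub> x \<in> I" using x by (auto simp: coset_eq_iff)
  have "T y \<ominus>\<^bsub>A\<^esub> T x \<in> I"
    using T(3)[OF y(2)] y(1) x by (simp add: lin_End_simps(5)[OF T(1)] sub_closed(1))
  then show ?thesis
    using y(1) x T(2) by (simp add: induced_def y_def[symmetric] coset_eq_iff)
qed

lemma induced_lin_End:
  assumes T: "T \<in> lin_End K A" "\<And>x. x \<in> H \<Longrightarrow> T x \<in> H" "\<And>x. x \<in> I \<Longrightarrow> T x \<in> I"
  shows "induced T \<in> lin_End K B"
proof -
  note ind = induced_coset[of T, OF T]
  note [simp] = lin_End_simps[OF T(1)] sub_closed coset_closed T(2)
  have "induced T u \<in> carrier B" if "u \<in> carrier B" for u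
    using that by (elim cosetE) (simp add: ind)
  moreover have "induced T (u \<oplus>\<^bsub>B\<^esub> v) = induced T u \<oplus>\<^bsub>B\<^esub> induced T v"
    if u: "u \<in> carrier B" and v: "v \<in> carrier B" for u v
  proof -
    obtain x where x: "x \<in> H" "u = HI.coset x" using u by (rule cosetE)
    obtain y where y: "y \<in> H" "v = HI.coset y" using v by (rule cosetE)
    from x y show ?thesis by (simp add: coset_add[symmetric] ind)
  qed
  moreover have "induced T (a \<odot>\<^bsub>B\<^esub> u) = a \<odot>\<^bsub>B\<^esub> induced T u" if a: "a \<in> carrier K" and u: "u \<in> carrier B" for a u
  proof -
    obtain x where x: "x \<in> H" "u = HI.coset x" using u by (rule cosetE)
    then show ?thesis using a by (simp add: coset_smult[symmetric] ind)
  qed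
  ultimately show ?thesis unfolding lin_End_def by blast
qed

end

section \<open>Pre-symplectic left-symmetric algebras in characteristic zero\<close>

lemma (in fd_algebra) left_mult_lin_End: "u \<in> carrier A \<Longrightarrow> (\<lambda>x. u \<otimes>\<^bsub>A\<^esub> x) \<in> lin_End K A"
  unfolding lin_End_def by (auto simp: prod_closed prod_add_right prod_smult_right)

lemma (in fd_algebra) right_mult_lin_End: "u \<in> carrier A \<Longrightarrow> (\<lambda>x. x \<otimes>\<^bsub>A\<^esub> u) \<in> lin_End K A"
  unfolding lin_End_def by (auto simp: prod_closed prod_add_left prod_smult_left)

lemmas (in fd_algebra) prod_minus_left = lin_End_simps(5)[OF right_mult_lin_End]
  and prod_zero_right = lin_End_simps(4)[OF left_mult_lin_End]
  and prod_zero_left = lin_End_simps(4)[OF right_mult_lin_End]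

lemma (in presymplectic_lsa) form_zero:
  assumes "x \<in> carrier A" shows "\<omega> \<zero>\<^bsub>A\<^esub> x = \<zero>" "\<omega> x \<zero>\<^bsub>A\<^esub> = \<zero>"
  using form_smult_left[of \<zero> x x] form_smult_right[of \<zero> x x] assms by (simp_all add: form_closed)

text \<open>
  Nondegeneracy makes the vector in the definite description unique, so it is \<open>0\<close> as soon as
  \<open>0\<close> has the defining property.
\<close>

lemma adjoint_eq_zero:
  fixes A :: "('k, 'a) module"
  assumes "presymplectic_lsa K A \<omega>"
    and orth: "\<And>u. u \<in> carrier A \<Longrightarrow> \<omega> (T u) v = \<zero>\<^bsub>K\<^esub>"
  shows "adjoint A \<omega> T v = \<zero>\<^bsub>A\<^esub>"
proof -
  interpret presymplectic_lsa K A \<omega> by fact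
  show ?thesis
    unfolding adjoint_def
  proof (rule the_equality)
  show "\<zero>\<^bsub>A\<^esub> \<in> carrier A \<and> (\<forall>u \<in> carrier A. \<omega> (T u) v = \<omega> u \<zero>\<^bsub>A\<^esub>)"
    using orth by (simp add: form_zero)
next
  fix w assume w: "w \<in> carrier A \<and> (\<forall>u \<in> carrier A. \<omega> (T u) v = \<omega> u w)"
  then have "\<omega> u w = \<zero>\<^bsub>K\<^esub>" if "u \<in> carrier A" for u
    using that orth[of u] by simp
  then have "\<omega> w u = \<zero>\<^bsub>K\<^esub>" if "u \<in> carrier A" for u
    using that w form_skew[of w u] by simp
  then show "w = \<zero>\<^bsub>A\<^esub>" using w form_nondegenerate by blast
  qed
qed

lemma (in domain) eq_neg_self_imp_zero:
  assumes "char_zero R" "a \<in> carrier R" "a = \<ominus> a" shows "a = \<zero>"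
proof -
  have "add_pow R (2::nat) \<one> \<noteq> \<zero>" using assms(1) unfolding char_zero_def by auto
  then have "\<one> \<oplus> \<one> \<noteq> \<zero>" by (simp add: numeral_2_eq_2 add_pow_def)
  moreover have "(\<one> \<oplus> \<one>) \<otimes> a = a \<oplus> a" using assms(2) by (simp add: l_distr)
  moreover have "a \<oplus> a = \<zero>"
    using assms(2) r_neg[of a] arg_cong[OF assms(3), of "\<lambda>b. a \<oplus> b"] by simp
  ultimately show ?thesis using assms(2) integral_iff[of "\<one> \<oplus> \<one>" a] by simp
qed

locale presymplectic_lsa_char_0 = presymplectic_lsa K A \<omega>
  for K (structure) and A :: "('a, 'c) module" (structure) and \<omega> +
  assumes char_zero: "char_zero K"
begin

lemma form_self: "x \<in> carrier A \<Longrightarrow> \<omega> x x = \<zero>"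
  using form_skew[of x x] form_closed eq_neg_self_imp_zero[OF char_zero] by blast

text \<open>
  By compatibility all left multiplications are symmetric with respect to \<open>\<omega>\<close>. Left symmetry turns
  \<open>L\<^bsub>[u,v]\<^esub>\<close> into the commutator of \<open>L\<^bsub>u\<^esub>\<close> and \<open>L\<^bsub>v\<^esub>\<close>, which is skew. Being both symmetric and skew,
  it vanishes.
\<close>

lemma left_mult_commutator_commute:
  assumes u: "u \<in> carrier A" and v: "v \<in> carrier A" and w: "w \<in> carrier A"
  shows left_mult_commutator: "(u \<otimes>\<^bsub>A\<^esub> v) \<otimes>\<^bsub>A\<^esub> w = (v \<otimes>\<^bsub>A\<^esub> u) \<otimes>\<^bsub>A\<^esub> w"
    and left_mult_commute: "u \<otimes>\<^bsub>A\<^esub> (v \<otimes>\<^bsub>A\<^esub> w) = v \<otimes>\<^bsub>A\<^esub> (u \<otimes>\<^bsub>A\<^esub> w)"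
proof -
  note [simp] = prod_closed form_minus form_closed
  define P where "P x = (u \<otimes>\<^bsub>A\<^esub> v) \<otimes>\<^bsub>A\<^esub> x \<ominus>\<^bsub>A\<^esub> (v \<otimes>\<^bsub>A\<^esub> u) \<otimes>\<^bsub>A\<^esub> x" for x
  have P2: "P x = u \<otimes>\<^bsub>A\<^esub> (v \<otimes>\<^bsub>A\<^esub> x) \<ominus>\<^bsub>A\<^esub> v \<otimes>\<^bsub>A\<^esub> (u \<otimes>\<^bsub>A\<^esub> x)" if "x \<in> carrier A" for x
    unfolding P_def using u v that by (rule_tac M.minus_swap[OF left_symmetric]) auto
  have P [simp]: "P x \<in> carrier A" if "x \<in> carrier A" for x unfolding P_def using u v that by simp
  have "\<omega> (P w) z = \<zero>" if z: "z \<in> carrier A" for z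
  proof -
    have "\<omega> (P w) z = \<omega> w (P z)"
      unfolding P_def using u v w z by (simp add: form_compatible)
    moreover have "\<omega> (P w) z = \<omega> w (v \<otimes>\<^bsub>A\<^esub> (u \<otimes>\<^bsub>A\<^esub> z)) \<ominus> \<omega> w (u \<otimes>\<^bsub>A\<^esub> (v \<otimes>\<^bsub>A\<^esub> z))"
      using u v w z by (simp add: P2 form_compatible)
    moreover have "\<omega> w (P z) = \<omega> w (u \<otimes>\<^bsub>A\<^esub> (v \<otimes>\<^bsub>A\<^esub> z)) \<ominus> \<omega> w (v \<otimes>\<^bsub>A\<^esub> (u \<otimes>\<^bsub>A\<^esub> z))"
      using u v w z by (simp add: P2)
    ultimately have "\<omega> (P w) z = \<ominus> \<omega> (P w) z"
      using w z minus_diff_swap[of "\<omega> w (v \<otimes>\<^bsub>A\<^esub> (u \<otimes>\<^bsub>A\<^esub> z))" "\<omega> w (u \<otimes>\<^bsub>A\<^esub> (v \<otimes>\<^bsub>A\<^esub> z))"] u v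
      by simp
    then show ?thesis using w z eq_neg_self_imp_zero[OF char_zero, of "\<omega> (P w) z"] by simp
  qed
  then have Pw: "P w = \<zero>\<^bsub>A\<^esub>" using form_nondegenerate w by simp
  then show "(u \<otimes>\<^bsub>A\<^esub> v) \<otimes>\<^bsub>A\<^esub> w = (v \<otimes>\<^bsub>A\<^esub> u) \<otimes>\<^bsub>A\<^esub> w"
    using u v w by (simp add: P_def M.minus_eq_zero_iff)
  show "u \<otimes>\<^bsub>A\<^esub> (v \<otimes>\<^bsub>A\<^esub> w) = v \<otimes>\<^bsub>A\<^esub> (u \<otimes>\<^bsub>A\<^esub> w)"
    using Pw u v w by (simp add: P2 M.minus_eq_zero_iff)
qed

lemma commutator_closed: "u \<in> carrier A \<Longrightarrow> v \<in> carrier A \<Longrightarrow> commutator A u v \<in> carrier A"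
  unfolding commutator_def by (simp add: prod_closed)

lemma commutator_ideal_submodule: "submodule (commutator_ideal K A) K A"
  unfolding commutator_ideal_def by (rule lin_span_submodule) (auto simp: commutator_closed)

lemma commutator_mem:
  "u \<in> carrier A \<Longrightarrow> v \<in> carrier A \<Longrightarrow> commutator A u v \<in> commutator_ideal K A"
  unfolding commutator_ideal_def by (rule lin_span_incl) auto

lemma commutator_ideal_mult_zero:
  assumes "c \<in> commutator_ideal K A" "w \<in> carrier A"
  shows "c \<otimes>\<^bsub>A\<^esub> w = \<zero>\<^bsub>A\<^esub>"
proof -
  let ?H = "{c \<in> carrier A. c \<otimes>\<^bsub>A\<^esub> w = \<zero>\<^bsub>A\<^esub>}"
  have "submodule ?H K A"
    using assms(2)
    by (intro submoduleI_smult) (auto simp: prod_zero_left prod_add_left prod_smult_left)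
  moreover have "{commutator A u v | u v. u \<in> carrier A \<and> v \<in> carrier A} \<subseteq> ?H"
    using assms(2) left_mult_commutator
    by (auto simp: commutator_closed, simp add: commutator_def prod_minus_left prod_closed
        M.minus_eq_zero_iff)
  ultimately have "commutator_ideal K A \<subseteq> ?H"
    unfolding commutator_ideal_def by (rule lin_span_least)
  then show ?thesis using assms by blast
qed

text \<open>Since \<open>c \<bullet> u = 0\<close>, the product \<open>u \<bullet> c\<close> is itself the commutator of \<open>u\<close> and \<open>c\<close>.\<close>

lemma commutator_ideal_left_ideal:
  assumes "c \<in> commutator_ideal K A" "u \<in> carrier A"
  shows "u \<otimes>\<^bsub>A\<^esub> c \<in> commutator_ideal K A"
proof -
  have c: "c \<in> carrier A" using assms submodule_closed(1)[OF commutator_ideal_submodule] by blast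
  have "commutator A u c = u \<otimes>\<^bsub>A\<^esub> c"
    using assms c by (simp add: commutator_def commutator_ideal_mult_zero prod_closed a_minus_def)
  then show ?thesis using commutator_mem[OF assms(2) c] by simp
qed

lemma orth_submodule: "F \<subseteq> carrier A \<Longrightarrow> submodule (orth K A \<omega> F) K A"
  by (rule submoduleI_smult)
    (auto simp: orth_def subset_iff form_zero form_add_left form_smult_left)

lemma orth_left_ideal:
  assumes "F \<subseteq> carrier A" "\<And>x. x \<in> F \<Longrightarrow> u \<otimes>\<^bsub>A\<^esub> x \<in> F" "u \<in> carrier A" "w \<in> orth K A \<omega> F"
  shows "u \<otimes>\<^bsub>A\<^esub> w \<in> orth K A \<omega> F"
  using assms by (auto simp: orth_def prod_closed form_compatible subset_iff)

text \<open>
  The left multiplications commute and leave \<open>[A,A] \<inter> [A,A]\<^sup>\<perp>\<close> invariant; an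
  eigenvector of those by a finite spanning set is one of all, since \<open>u \<mapsto> u \<bullet> e\<close> is linear.
\<close>

lemma ex_common_eigenvector_left_mult:
  assumes "algebraically_closed K" "degenerate K A \<omega> (commutator_ideal K A)"
  shows "\<exists>e \<in> commutator_ideal K A \<inter> orth K A \<omega> (commutator_ideal K A). e \<noteq> \<zero>\<^bsub>A\<^esub> \<and>
    (\<forall>u \<in> carrier A. \<exists>\<alpha> \<in> carrier K. u \<otimes>\<^bsub>A\<^esub> e = \<alpha> \<odot>\<^bsub>A\<^esub> e)"
proof -
  let ?C = "commutator_ideal K A"
  let ?J = "?C \<inter> orth K A \<omega> ?C"
  note C = submodule_closed[OF commutator_ideal_submodule]
  have CA: "?C \<subseteq> carrier A" using C(1) by blast
  note O = submodule_closed[OF orth_submodule[OF CA]]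
  have J: "submodule ?J K A" by (rule submoduleI_smult) (use CA C O in auto)
  have inv: "u \<otimes>\<^bsub>A\<^esub> x \<in> ?J" if "u \<in> carrier A" "x \<in> ?J" for u x
    using that orth_left_ideal[OF CA] commutator_ideal_left_ideal by blast
  obtain S where S: "finite S" "S \<subseteq> carrier A" "lin_span K A S = carrier A"
    using fin_dim unfolding fin_dim_def by blast
  have "?J \<noteq> {\<zero>\<^bsub>A\<^esub>}" using assms(2) unfolding degenerate_def .
  then have "\<exists>x \<in> ?J. x \<noteq> \<zero>\<^bsub>A\<^esub> \<and> (\<forall>s \<in> S. \<exists>\<alpha> \<in> carrier K. s \<otimes>\<^bsub>A\<^esub> x = \<alpha> \<odot>\<^bsub>A\<^esub> x)"
    using S(2) inv left_mult_lin_End left_mult_commute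
    by (intro ex_common_eigenvector[OF assms(1) fin_dim S(1) _ _ J, of "\<lambda>u x. u \<otimes>\<^bsub>A\<^esub> x"]) blast+
  then obtain e where e: "e \<in> ?J" "e \<noteq> \<zero>\<^bsub>A\<^esub>" "\<forall>s \<in> S. \<exists>\<alpha> \<in> carrier K. s \<otimes>\<^bsub>A\<^esub> e = \<alpha> \<odot>\<^bsub>A\<^esub> e"
    by blast
  have eA [simp]: "e \<in> carrier A" using e CA by blast
  let ?U = "{u \<in> carrier A. \<exists>\<alpha> \<in> carrier K. u \<otimes>\<^bsub>A\<^esub> e = \<alpha> \<odot>\<^bsub>A\<^esub> e}"
  have "submodule ?U K A"
  proof (rule submoduleI_smult)
    show "\<zero>\<^bsub>A\<^esub> \<in> ?U" by (auto simp: prod_zero_left intro: bexI[of _ \<zero>])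
  next
    fix x y assume "x \<in> ?U" "y \<in> ?U"
    then obtain a b where "x \<in> carrier A" "y \<in> carrier A" "a \<in> carrier K" "b \<in> carrier K"
      "x \<otimes>\<^bsub>A\<^esub> e = a \<odot>\<^bsub>A\<^esub> e" "y \<otimes>\<^bsub>A\<^esub> e = b \<odot>\<^bsub>A\<^esub> e" by blast
    then show "x \<oplus>\<^bsub>A\<^esub> y \<in> ?U"
      by (auto simp: prod_add_left smult_l_distr intro!: bexI[of _ "a \<oplus> b"])
  next
    fix c x assume c: "c \<in> carrier K" and "x \<in> ?U"
    then obtain a where "x \<in> carrier A" "a \<in> carrier K" "x \<otimes>\<^bsub>A\<^esub> e = a \<odot>\<^bsub>A\<^esub> e" by blast
    then show "c \<odot>\<^bsub>A\<^esub> x \<in> ?U" using c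
      by (auto simp: prod_smult_left smult_assoc1 intro!: bexI[of _ "c \<otimes> a"])
  qed auto
  then have "lin_span K A S \<subseteq> ?U" by (rule lin_span_least) (use S(2) e(3) in blast)
  then show ?thesis using e S(3) by blast
qed

end

section \<open>The double extension attached to an invariant isotropic line\<close>

text \<open>
  The vector \<open>e\<close> spans the ideal and \<open>d\<close> is a dual vector. That all weights of \<open>A\<close> on \<open>e\<close> are
  multiples of \<open>\<omega> e\<close> is what membership of \<open>e\<close> in \<open>[A,A]\<^sup>\<perp>\<close> amounts to.
\<close>

locale invariant_line = presymplectic_lsa_char_0 +
  fixes e d :: 'c and lam :: 'a
  assumes e_closed [simp]: "e \<in> carrier A" and d_closed [simp]: "d \<in> carrier A"
    and lam_closed [simp]: "lam \<in> carrier K"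
    and form_e_d [simp]: "\<omega> e d = \<one>"
    and e_mult: "u \<in> carrier A \<Longrightarrow> e \<otimes>\<^bsub>A\<^esub> u = \<zero>\<^bsub>A\<^esub>"
    and mult_e: "u \<in> carrier A \<Longrightarrow> u \<otimes>\<^bsub>A\<^esub> e = (lam \<otimes> \<omega> e u) \<odot>\<^bsub>A\<^esub> e"
begin

lemmas [simp] = form_closed prod_closed

definition line :: "'c set" where "line = {a \<odot>\<^bsub>A\<^esub> e | a. a \<in> carrier K}"

abbreviation "H \<equiv> orth K A \<omega> line"

lemma lineI: "a \<in> carrier K \<Longrightarrow> a \<odot>\<^bsub>A\<^esub> e \<in> line"
  unfolding line_def by blast

lemma lineE: assumes "x \<in> line" obtains a where "a \<in> carrier K" "x = a \<odot>\<^bsub>A\<^esub> e"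
  using assms unfolding line_def by blast

lemma line_subset: "line \<subseteq> carrier A"
  by (auto elim: lineE)

lemma line_submodule: "submodule line K A"
proof (rule submoduleI_smult)
  have "\<zero> \<odot>\<^bsub>A\<^esub> e \<in> line" by (rule lineI) simp
  then show "\<zero>\<^bsub>A\<^esub> \<in> line" by simp
  show "x \<oplus>\<^bsub>A\<^esub> y \<in> line" if x: "x \<in> line" and y: "y \<in> line" for x y
  proof -
    obtain a where "a \<in> carrier K" "x = a \<odot>\<^bsub>A\<^esub> e" using x by (rule lineE)
    moreover obtain b where "b \<in> carrier K" "y = b \<odot>\<^bsub>A\<^esub> e" using y by (rule lineE)
    ultimately show ?thesis using lineI[of "a \<oplus> b"] by (simp add: smult_l_distr)
  qed
  show "c \<odot>\<^bsub>A\<^esub> x \<in> line" if c: "c \<in> carrier K" and x: "x \<in> line" for c x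
  proof -
    obtain a where "a \<in> carrier K" "x = a \<odot>\<^bsub>A\<^esub> e" using x by (rule lineE)
    then show ?thesis using lineI[of "c \<otimes> a"] c by (simp add: smult_assoc1)
  qed
qed (rule line_subset)

lemma line_ideal: "two_sided_ideal K A line"
  unfolding two_sided_ideal_def
proof (intro conjI ballI line_submodule)
  fix x u assume x: "x \<in> line" and u: "u \<in> carrier A"
  obtain a where a: "a \<in> carrier K" "x = a \<odot>\<^bsub>A\<^esub> e" using x by (rule lineE)
  show "u \<otimes>\<^bsub>A\<^esub> x \<in> line"
    using a u lineI[of "a \<otimes> (lam \<otimes> \<omega> e u)"] by (simp add: prod_smult_right mult_e smult_assoc1)
  show "x \<otimes>\<^bsub>A\<^esub> u \<in> line"
    using a u submodule_closed(2)[OF line_submodule] by (simp add: prod_smult_left e_mult)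
qed

lemma mem_orth_line_iff: "x \<in> H \<longleftrightarrow> x \<in> carrier A \<and> \<omega> e x = \<zero>"
proof
  assume x: "x \<in> H"
  have "\<one> \<odot>\<^bsub>A\<^esub> e \<in> line" by (rule lineI) simp
  then have "\<omega> x e = \<zero>" using x by (simp add: orth_def)
  then show "x \<in> carrier A \<and> \<omega> e x = \<zero>" using x form_skew[of e x] by (simp add: orth_def)
next
  assume x: "x \<in> carrier A \<and> \<omega> e x = \<zero>"
  then have "\<omega> x e = \<zero>" using form_skew[of x e] by simp
  then show "x \<in> H" using x by (auto simp: orth_def form_smult_right elim!: lineE)
qed

lemma line_isotropic: "totally_isotropic K A \<omega> line"
  unfolding totally_isotropic_def
  by (auto elim!: lineE simp: mem_orth_line_iff form_smult_right form_self)

text \<open>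
  Modulo \<open>e\<^sup>\<perp>\<close> the product is thus that of a line, and \<open>e\<^sup>\<perp>\<close> is a two-sided ideal.
\<close>

lemma form_e_mult:
  assumes "u \<in> carrier A" "v \<in> carrier A"
  shows "\<omega> e (u \<otimes>\<^bsub>A\<^esub> v) = lam \<otimes> \<omega> e u \<otimes> \<omega> e v"
  using assms form_compatible[of u e v] by (simp add: mult_e form_smult_left)

lemma orth_line_ideal: "two_sided_ideal K A H"
  unfolding two_sided_ideal_def
  using orth_submodule[OF line_subset] by (auto simp: mem_orth_line_iff form_e_mult)

lemmas orth_closed = submodule_closed[OF orth_submodule[OF line_subset]]

text \<open>The projection onto \<open>H\<close> along \<open>d\<close>.\<close>

definition proj :: "'c \<Rightarrow> 'c" where "proj x = x \<ominus>\<^bsub>A\<^esub> \<omega> e x \<odot>\<^bsub>A\<^esub> d"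

lemma proj_mem: "x \<in> carrier A \<Longrightarrow> proj x \<in> H"
  by (simp add: proj_def mem_orth_line_iff form_minus form_smult_right)

lemma proj_decomp: "x \<in> carrier A \<Longrightarrow> x = \<omega> e x \<odot>\<^bsub>A\<^esub> d \<oplus>\<^bsub>A\<^esub> proj x"
  by (simp add: proj_def a_minus_def M.a_comm[of "x"] M.r_neg2)

lemma proj_lin_End: "proj \<in> lin_End K A"
proof -
  have "proj (x \<oplus>\<^bsub>A\<^esub> y) = proj x \<oplus>\<^bsub>A\<^esub> proj y" if "x \<in> carrier A" "y \<in> carrier A" for x y
    using that by (simp add: proj_def form_add_right smult_l_distr a_minus_def M.minus_add M.a_ac)
  moreover have "proj (a \<odot>\<^bsub>A\<^esub> x) = a \<odot>\<^bsub>A\<^esub> proj x" if "a \<in> carrier K" "x \<in> carrier A" for a x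
    using that
    by (simp add: proj_def form_smult_right smult_assoc1 a_minus_def smult_r_distr smult_r_minus)
  moreover have "proj x \<in> carrier A" if "x \<in> carrier A" for x
    using that by (simp add: proj_def)
  ultimately show ?thesis unfolding lin_End_def by blast
qed

lemma proj_orth: "x \<in> H \<Longrightarrow> proj x = x"
  by (simp add: proj_def mem_orth_line_iff M.minus_zero_right)

lemma orth_line_module: "module K (subalg A H)"
  unfolding subalg_def
  by (rule submodule.submodule_is_module[OF orth_submodule[OF line_subset]]) unfold_locales

text \<open>
  A finite spanning set of \<open>A\<close> projects to one of \<open>H\<close>.
\<close>

lemma orth_line_fin_dim: "fin_dim K (subalg A H)"
proof (rule fin_dim_image[OF fin_dim orth_line_module, of proj])
  have "x \<in> proj ` carrier A" if "x \<in> H" for x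
    using proj_orth[OF that] orth_closed(1)[OF that] by (metis imageI)
  then show "proj ` carrier A = carrier (subalg A H)" using proj_mem by (auto simp: subalg_def)
qed (simp_all add: subalg_def lin_End_simps[OF proj_lin_End])

text \<open>
  This is \<open>I\<^sup>\<perp>\<^sup>\<perp> = I\<close> without a dimension count: \<open>A\<close> is spanned by \<open>H\<close> and \<open>d\<close>, and subtracting a suitable
  multiple of \<open>e\<close> from \<open>x\<close> makes it orthogonal to \<open>d\<close> as well.
\<close>

lemma orth_line_radical:
  assumes x: "x \<in> H" shows "x \<in> line \<longleftrightarrow> (\<forall>y \<in> H. \<omega> x y = \<zero>)"
proof
  assume "x \<in> line"
  then obtain a where a: "a \<in> carrier K" "x = a \<odot>\<^bsub>A\<^esub> e" by (rule lineE)
  then show "\<forall>y \<in> H. \<omega> x y = \<zero>" by (simp add: mem_orth_line_iff form_smult_left)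
next
  assume orth: "\<forall>y \<in> H. \<omega> x y = \<zero>"
  have xA [simp]: "x \<in> carrier A" using x by (simp add: mem_orth_line_iff)
  let ?y = "x \<ominus>\<^bsub>A\<^esub> \<omega> x d \<odot>\<^bsub>A\<^esub> e"
  have "\<omega> ?y z = \<zero>" if z: "z \<in> carrier A" for z
  proof -
    have "\<omega> ?y (proj z) = \<zero>"
      using proj_mem[OF z] orth by (simp add: form_minus form_smult_left mem_orth_line_iff)
    moreover have "\<omega> ?y d = \<zero>" by (simp add: form_minus form_smult_left)
    ultimately have "\<omega> ?y (\<omega> e z \<odot>\<^bsub>A\<^esub> d \<oplus>\<^bsub>A\<^esub> proj z) = \<zero>"
      using z orth_closed(1)[OF proj_mem[OF z]] by (simp add: form_add_right form_smult_right)
    then show ?thesis using proj_decomp[OF z] by simp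
  qed
  then have "?y = \<zero>\<^bsub>A\<^esub>" using form_nondegenerate[of ?y] by simp
  then have "x = \<omega> x d \<odot>\<^bsub>A\<^esub> e" by (simp add: M.minus_eq_zero_iff)
  then show "x \<in> line" using lineI[of "\<omega> x d"] by simp
qed

sublocale reduction K A \<omega> H line
proof (intro reduction.intro reduction_axioms.intro presymplectic_lsa_axioms)
  show "two_sided_ideal K (subalg A H) line"
  proof -
    have "submodule line K (subalg A H)"
      using line_isotropic submodule_closed[OF line_submodule]
      by (intro module.submoduleI_smult[OF orth_line_module])
        (auto simp: subalg_def totally_isotropic_def)
    then show ?thesis using line_ideal orth_closed(1)
      unfolding two_sided_ideal_def by (auto simp: subalg_def)
  qed
qed (use orth_submodule[OF line_subset] orth_line_ideal orth_line_fin_dim orth_line_radical orth_closed(1)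
    in \<open>auto simp: two_sided_ideal_def\<close>)


subsection \<open>The data\<close>

lemma orth_line_mult:
  assumes "x \<in> H" "u \<in> carrier A"
  shows "u \<otimes>\<^bsub>A\<^esub> x \<in> H" "x \<otimes>\<^bsub>A\<^esub> u \<in> H"
  using orth_line_ideal assms unfolding two_sided_ideal_def by auto

lemma line_mult:
  assumes "x \<in> line" "u \<in> carrier A"
  shows "u \<otimes>\<^bsub>A\<^esub> x \<in> line" "x \<otimes>\<^bsub>A\<^esub> u \<in> line"
  using line_ideal assms unfolding two_sided_ideal_def by auto

definition D where "D = induced (\<lambda>x. x \<otimes>\<^bsub>A\<^esub> d)"

definition \<xi> where "\<xi> = induced (\<lambda>x. d \<otimes>\<^bsub>A\<^esub> x)"

definition b\<^sub>0 where "b\<^sub>0 = proj (d \<otimes>\<^bsub>A\<^esub> d)"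

lemma D_coset: "x \<in> H \<Longrightarrow> D (HI.coset x) = HI.coset (x \<otimes>\<^bsub>A\<^esub> d)"
  unfolding D_def by (rule induced_coset) (simp_all add: right_mult_lin_End orth_line_mult line_mult)

lemma \<xi>_coset: "x \<in> H \<Longrightarrow> \<xi> (HI.coset x) = HI.coset (d \<otimes>\<^bsub>A\<^esub> x)"
  unfolding \<xi>_def by (rule induced_coset) (simp_all add: left_mult_lin_End orth_line_mult line_mult)

lemma b0_mem [simp]: "b\<^sub>0 \<in> H"
  unfolding b\<^sub>0_def by (simp add: proj_mem)

lemma b0_closed [simp]: "b\<^sub>0 \<in> carrier A"
  by (rule orth_closed(1)[OF b0_mem])

lemma form_e_d_d: "\<omega> e (d \<otimes>\<^bsub>A\<^esub> d) = lam"
  by (simp add: form_e_mult)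

lemma d_mult_d: "d \<otimes>\<^bsub>A\<^esub> d = lam \<odot>\<^bsub>A\<^esub> d \<oplus>\<^bsub>A\<^esub> b\<^sub>0"
  using proj_decomp[of "d \<otimes>\<^bsub>A\<^esub> d"] by (simp add: form_e_d_d b\<^sub>0_def)

text \<open>A symmetric map \<open>L\<^sub>x\<close> sends every vector into its own orthogonal, as \<open>\<omega>\<close> is skew.\<close>

lemma form_self_mult:
  assumes "x \<in> carrier A" "y \<in> carrier A"
  shows "\<omega> (x \<otimes>\<^bsub>A\<^esub> y) y = \<zero>" "\<omega> y (x \<otimes>\<^bsub>A\<^esub> y) = \<zero>"
proof -
  have "\<omega> (x \<otimes>\<^bsub>A\<^esub> y) y = \<ominus> \<omega> (x \<otimes>\<^bsub>A\<^esub> y) y"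
    using assms form_compatible[of x y y] form_skew[of y "x \<otimes>\<^bsub>A\<^esub> y"] by simp
  then show "\<omega> (x \<otimes>\<^bsub>A\<^esub> y) y = \<zero>" using assms eq_neg_self_imp_zero[OF char_zero] by simp
  then show "\<omega> y (x \<otimes>\<^bsub>A\<^esub> y) = \<zero>" using assms form_compatible[of x y y] by simp
qed

text \<open>
  The form \<open>(x, y) \<mapsto> \<omega> (x v) (y v)\<close> equals \<open>\<omega> v (x (y v))\<close>, hence is symmetric, because left
  multiplications commute, as well as skew.
\<close>

lemma form_mult_mult_right:
  assumes x: "x \<in> carrier A" and y: "y \<in> carrier A" and v: "v \<in> carrier A"
  shows "\<omega> (x \<otimes>\<^bsub>A\<^esub> v) (y \<otimes>\<^bsub>A\<^esub> v) = \<zero>"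
proof -
  have "\<omega> (x \<otimes>\<^bsub>A\<^esub> v) (y \<otimes>\<^bsub>A\<^esub> v) = \<omega> v (x \<otimes>\<^bsub>A\<^esub> (y \<otimes>\<^bsub>A\<^esub> v))"
    using x y v by (simp add: form_compatible)
  also have "\<dots> = \<omega> v (y \<otimes>\<^bsub>A\<^esub> (x \<otimes>\<^bsub>A\<^esub> v))" using left_mult_commute[OF x y v] by simp
  also have "\<dots> = \<omega> (y \<otimes>\<^bsub>A\<^esub> v) (x \<otimes>\<^bsub>A\<^esub> v)" using x y v by (simp add: form_compatible)
  also have "\<dots> = \<ominus> \<omega> (x \<otimes>\<^bsub>A\<^esub> v) (y \<otimes>\<^bsub>A\<^esub> v)" using x y v by (simp add: form_skew[of "y \<otimes>\<^bsub>A\<^esub> v"])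
  finally show ?thesis using x y v by (intro eq_neg_self_imp_zero[OF char_zero]) simp
qed

lemma double_extension_data: "double_extension_data K B \<omega>\<^sub>B D \<xi> (HI.coset b\<^sub>0) lam"
proof (intro double_extension_data.intro double_extension_data_axioms.intro B.presymplectic_lsa_axioms)
  show "D \<in> lin_End K B"
    unfolding D_def
    by (rule induced_lin_End) (simp_all add: right_mult_lin_End orth_line_mult line_mult)
  show "\<xi> \<in> lin_End K B"
    unfolding \<xi>_def
    by (rule induced_lin_End) (simp_all add: left_mult_lin_End orth_line_mult line_mult)
  show "HI.coset b\<^sub>0 \<in> carrier B" "lam \<in> carrier K" by (simp_all add: coset_closed)
  note push = coset_mult[symmetric] coset_minus[symmetric] coset_add[symmetric]
    coset_smult[symmetric] D_coset \<xi>_coset quot_form_coset coset_zero[symmetric]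
  note [simp] = orth_closed orth_line_mult
  have D_orth: "\<omega>\<^sub>B (D u) (HI.coset y) = \<zero>" if u: "u \<in> carrier B" and y: "y \<in> H"
    and orth: "\<And>x. x \<in> H \<Longrightarrow> \<omega> (x \<otimes>\<^bsub>A\<^esub> d) y = \<zero>" for u y
  proof -
    obtain x where "x \<in> H" "u = HI.coset x" using u by (rule cosetE)
    then show ?thesis using y orth by (simp add: push)
  qed
  have "\<omega> (x \<otimes>\<^bsub>A\<^esub> d) b\<^sub>0 = \<zero>" if "x \<in> H" for x
    unfolding b\<^sub>0_def proj_def using that
    by (simp add: form_minus form_smult_right form_mult_mult_right form_self_mult)
  then show "adjoint B \<omega>\<^sub>B D (HI.coset b\<^sub>0) = \<zero>\<^bsub>B\<^esub>"
    by (intro adjoint_eq_zero[OF B.presymplectic_lsa_axioms] D_orth) auto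
  fix u assume u: "u \<in> carrier B"
  obtain x where x: "x \<in> H" "u = HI.coset x" using u by (rule cosetE)
  have xA [simp]: "x \<in> carrier A" using x by simp
  have "adjoint B \<omega>\<^sub>B D (HI.coset (x \<otimes>\<^bsub>A\<^esub> d)) = \<zero>\<^bsub>B\<^esub>"
    using x by (intro adjoint_eq_zero[OF B.presymplectic_lsa_axioms] D_orth) (simp_all add: form_mult_mult_right)
  then show "adjoint B \<omega>\<^sub>B D (D u) = \<zero>\<^bsub>B\<^esub>" using x by (simp add: D_coset)
  have "d \<otimes>\<^bsub>A\<^esub> (x \<otimes>\<^bsub>A\<^esub> d) = lam \<odot>\<^bsub>A\<^esub> (x \<otimes>\<^bsub>A\<^esub> d) \<oplus>\<^bsub>A\<^esub> x \<otimes>\<^bsub>A\<^esub> b\<^sub>0"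
    using left_mult_commute[of d x d] by (simp add: d_mult_d prod_add_right prod_smult_right)
  then show "\<xi> (D u) = lam \<odot>\<^bsub>B\<^esub> D u \<oplus>\<^bsub>B\<^esub> u \<otimes>\<^bsub>B\<^esub> HI.coset b\<^sub>0" using x by (simp add: push)
  show "D (D u) = D (\<xi> u)" using x left_mult_commutator[of x d d] by (simp add: push)
  fix v assume v: "v \<in> carrier B"
  obtain y where y: "y \<in> H" "v = HI.coset y" using v by (rule cosetE)
  have yA [simp]: "y \<in> carrier A" using y by simp
  show "\<omega>\<^sub>B (\<xi> u) v = \<omega>\<^sub>B u (\<xi> v)" using x y by (simp add: push form_compatible)
  have "(x \<otimes>\<^bsub>A\<^esub> y \<ominus>\<^bsub>A\<^esub> y \<otimes>\<^bsub>A\<^esub> x) \<otimes>\<^bsub>A\<^esub> d = \<zero>\<^bsub>A\<^esub>"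
    using left_mult_commutator[of x y d] by (simp add: prod_minus_left M.minus_eq_zero_iff)
  then show "D (commutator B u v) = \<zero>\<^bsub>B\<^esub>" using x y by (simp add: commutator_def push)
  show "u \<otimes>\<^bsub>B\<^esub> D v = v \<otimes>\<^bsub>B\<^esub> D u" using x y left_mult_commute[of x y d] by (simp add: push)
  show "D u \<otimes>\<^bsub>B\<^esub> v = \<xi> u \<otimes>\<^bsub>B\<^esub> v" using x y left_mult_commutator[of x d y] by (simp add: push)
  show "\<xi> (u \<otimes>\<^bsub>B\<^esub> v) = u \<otimes>\<^bsub>B\<^esub> \<xi> v" using x y left_mult_commute[of d x y] by (simp add: push)
qed

subsection \<open>The isomorphism\<close>

definition split_iso :: "'c \<Rightarrow> 'a \<times> 'c set \<times> 'a"
  where "split_iso x = (\<omega> e x, HI.coset (proj x), \<omega> x d)"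

lemma splitE:
  assumes "x \<in> carrier A"
  obtains a s where "a \<in> carrier K" "s \<in> H" "x = a \<odot>\<^bsub>A\<^esub> d \<oplus>\<^bsub>A\<^esub> s"
  using proj_decomp[OF assms] proj_mem[OF assms] assms by (rule_tac that) auto

lemma form_split:
  assumes "a \<in> carrier K" "s \<in> H"
  shows "\<omega> e (a \<odot>\<^bsub>A\<^esub> d \<oplus>\<^bsub>A\<^esub> s) = a"
  using assms by (simp add: mem_orth_line_iff form_add_right form_smult_right)

lemma split_iso_split:
  assumes a: "a \<in> carrier K" and s: "s \<in> H"
  shows "split_iso (a \<odot>\<^bsub>A\<^esub> d \<oplus>\<^bsub>A\<^esub> s) = (a, HI.coset s, \<omega> s d)"
proof -
  have sA: "s \<in> carrier A" using s by (rule orth_closed(1))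
  have "proj (a \<odot>\<^bsub>A\<^esub> d \<oplus>\<^bsub>A\<^esub> s) = s"
    unfolding proj_def form_split[OF a s] using a sA by (simp add: M.add_minus_cancel)
  moreover have "\<omega> (a \<odot>\<^bsub>A\<^esub> d \<oplus>\<^bsub>A\<^esub> s) d = \<omega> s d"
    using a sA by (simp add: form_add_left form_smult_left form_self)
  ultimately show ?thesis by (simp add: split_iso_def form_split[OF a s])
qed

abbreviation "E \<equiv> double_ext_alg K B \<omega>\<^sub>B D \<xi> (HI.coset b\<^sub>0) lam"

lemma split_iso_inj: "inj_on split_iso (carrier A)"
proof (rule inj_onI)
  fix x y assume x: "x \<in> carrier A" and y: "y \<in> carrier A" and eq: "split_iso x = split_iso y"
  obtain a s where s: "a \<in> carrier K" "s \<in> H" "x = a \<odot>\<^bsub>A\<^esub> d \<oplus>\<^bsub>A\<^esub> s" using x by (rule splitE)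
  obtain b t where t: "b \<in> carrier K" "t \<in> H" "y = b \<odot>\<^bsub>A\<^esub> d \<oplus>\<^bsub>A\<^esub> t" using y by (rule splitE)
  have [simp]: "s \<in> carrier A" "t \<in> carrier A" using s t by (simp_all add: orth_closed)
  have ab: "a = b" and "HI.coset s = HI.coset t" and f: "\<omega> s d = \<omega> t d"
    using eq s t by (simp_all add: split_iso_split)
  then have "s \<ominus>\<^bsub>A\<^esub> t \<in> line" using s t by (simp add: coset_eq_iff)
  then obtain c where c: "c \<in> carrier K" "s \<ominus>\<^bsub>A\<^esub> t = c \<odot>\<^bsub>A\<^esub> e" by (rule lineE)
  have "\<omega> (s \<ominus>\<^bsub>A\<^esub> t) d = \<zero>" using f by (simp add: form_minus)
  then have "c = \<zero>" using c by (simp add: form_smult_left)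
  then have "s = t" using c by (simp add: M.minus_eq_zero_iff)
  then show "x = y" using s t ab by simp
qed

lemma split_iso_surj: "split_iso ` carrier A = carrier E"
proof
  show "split_iso ` carrier A \<subseteq> carrier E"
    by (auto simp: split_iso_def double_ext_alg_def coset_closed proj_mem)
  show "carrier E \<subseteq> split_iso ` carrier A"
  proof
    fix z assume "z \<in> carrier E"
    then obtain a u c where z: "z = (a, u, c)" "a \<in> carrier K" "u \<in> carrier B" "c \<in> carrier K"
      by (auto simp: double_ext_alg_def)
    obtain s where s: "s \<in> H" "u = HI.coset s" using z(3) by (rule cosetE)
    have sA [simp]: "s \<in> carrier A" using s(1) by (rule orth_closed(1))
    \<comment> \<open>Adding a multiple of \<open>e\<close> does not change the coset and adjusts the last coordinate.\<close>
    define h where "h = (c \<ominus> \<omega> s d) \<odot>\<^bsub>A\<^esub> e"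
    have h: "h \<in> line" unfolding h_def using z by (intro lineI) simp
    then have hH: "h \<in> H" using line_isotropic unfolding totally_isotropic_def by blast
    then have hA [simp]: "h \<in> carrier A" by (rule orth_closed(1))
    let ?s = "s \<oplus>\<^bsub>A\<^esub> h"
    have sH: "?s \<in> H" using s(1) hH by (rule orth_closed(3))
    have "?s \<ominus>\<^bsub>A\<^esub> s = h" by (simp add: M.add_minus_cancel)
    then have "HI.coset ?s = u" using s h sH by (simp add: coset_eq_iff)
    moreover have "\<omega> ?s d = \<omega> s d \<oplus> (c \<ominus> \<omega> s d)"
      using z by (simp add: h_def form_add_left form_smult_left)
    moreover have "\<omega> s d \<oplus> (c \<ominus> \<omega> s d) = c" using z by (simp add: add_diff_self)
    ultimately have "split_iso (a \<odot>\<^bsub>A\<^esub> d \<oplus>\<^bsub>A\<^esub> ?s) = z" using z sH by (simp add: split_iso_split)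
    moreover have "a \<odot>\<^bsub>A\<^esub> d \<oplus>\<^bsub>A\<^esub> ?s \<in> carrier A" using z by simp
    ultimately show "z \<in> split_iso ` carrier A" by blast
  qed
qed

text \<open>
  With \<open>x = a d + s\<close> and \<open>y = b d + t\<close> for \<open>s, t \<in> H\<close>, the product is expanded as \<open>lam a b d + S\<close>. The last
  coordinate \<open>\<omega>(S, d)\<close> produces the cocycle terms \<open>\<omega>(b\<^sub>0, t)\<close> and \<open>\<omega>(D s, t)\<close> of the double extension,
  by moving left multiplications across the form.
\<close>

lemma split_iso_mult:
  assumes x: "x \<in> carrier A" and y: "y \<in> carrier A"
  shows "split_iso (x \<otimes>\<^bsub>A\<^esub> y) = split_iso x \<otimes>\<^bsub>E\<^esub> split_iso y"
proof -
  obtain a s where s: "a \<in> carrier K" "s \<in> H" "x = a \<odot>\<^bsub>A\<^esub> d \<oplus>\<^bsub>A\<^esub> s" using x by (rule splitE)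
  obtain b t where t: "b \<in> carrier K" "t \<in> H" "y = b \<odot>\<^bsub>A\<^esub> d \<oplus>\<^bsub>A\<^esub> t" using y by (rule splitE)
  have [simp]: "s \<in> carrier A" "t \<in> carrier A" using s t by (simp_all add: orth_closed)
  note [simp] = s(1) t(1) orth_closed(1)
  let ?S = "(a \<otimes> b) \<odot>\<^bsub>A\<^esub> b\<^sub>0 \<oplus>\<^bsub>A\<^esub> a \<odot>\<^bsub>A\<^esub> (d \<otimes>\<^bsub>A\<^esub> t) \<oplus>\<^bsub>A\<^esub> b \<odot>\<^bsub>A\<^esub> (s \<otimes>\<^bsub>A\<^esub> d) \<oplus>\<^bsub>A\<^esub> s \<otimes>\<^bsub>A\<^esub> t"
  have mems: "(a \<otimes> b) \<odot>\<^bsub>A\<^esub> b\<^sub>0 \<in> H" "a \<odot>\<^bsub>A\<^esub> (d \<otimes>\<^bsub>A\<^esub> t) \<in> H" "b \<odot>\<^bsub>A\<^esub> (s \<otimes>\<^bsub>A\<^esub> d) \<in> H"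
    "s \<otimes>\<^bsub>A\<^esub> t \<in> H" "d \<otimes>\<^bsub>A\<^esub> t \<in> H" "s \<otimes>\<^bsub>A\<^esub> d \<in> H"
    using s(2) t(2) by (simp_all add: orth_closed(5) orth_line_mult)
  have mems': "(a \<otimes> b) \<odot>\<^bsub>A\<^esub> b\<^sub>0 \<oplus>\<^bsub>A\<^esub> a \<odot>\<^bsub>A\<^esub> (d \<otimes>\<^bsub>A\<^esub> t) \<in> H"
    "(a \<otimes> b) \<odot>\<^bsub>A\<^esub> b\<^sub>0 \<oplus>\<^bsub>A\<^esub> a \<odot>\<^bsub>A\<^esub> (d \<otimes>\<^bsub>A\<^esub> t) \<oplus>\<^bsub>A\<^esub> b \<odot>\<^bsub>A\<^esub> (s \<otimes>\<^bsub>A\<^esub> d) \<in> H" "?S \<in> H"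
    by (intro orth_closed(3) mems)+
  have "x \<otimes>\<^bsub>A\<^esub> y = (lam \<otimes> (a \<otimes> b)) \<odot>\<^bsub>A\<^esub> d \<oplus>\<^bsub>A\<^esub> ?S"
    unfolding s(3) t(3)
    by (simp add: prod_add_left prod_add_right prod_smult_left prod_smult_right d_mult_d
        smult_r_distr smult_assoc1[symmetric] m_ac M.a_ac)
  then have "split_iso (x \<otimes>\<^bsub>A\<^esub> y) = (lam \<otimes> (a \<otimes> b), HI.coset ?S, \<omega> ?S d)"
    using mems'(3) by (simp add: split_iso_split)
  moreover have "HI.coset ?S = (a \<otimes> b) \<odot>\<^bsub>B\<^esub> HI.coset b\<^sub>0 \<oplus>\<^bsub>B\<^esub> a \<odot>\<^bsub>B\<^esub> \<xi> (HI.coset t)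
      \<oplus>\<^bsub>B\<^esub> b \<odot>\<^bsub>B\<^esub> D (HI.coset s) \<oplus>\<^bsub>B\<^esub> HI.coset s \<otimes>\<^bsub>B\<^esub> HI.coset t"
    using mems mems' s(2) t(2) by (simp add: coset_add coset_smult coset_mult D_coset \<xi>_coset)
  moreover have "\<omega> ?S d = lam \<otimes> (a \<otimes> \<omega> t d) \<ominus> a \<otimes> \<omega> b\<^sub>0 t \<ominus> \<omega> (s \<otimes>\<^bsub>A\<^esub> d) t"
  proof -
    have "\<omega> b\<^sub>0 d = \<zero>"
      unfolding b\<^sub>0_def proj_def
      by (simp add: form_minus form_smult_left form_self form_self_mult)
    moreover have "\<omega> (d \<otimes>\<^bsub>A\<^esub> t) d = lam \<otimes> \<omega> t d \<ominus> \<omega> b\<^sub>0 t"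
      using form_skew[of t b\<^sub>0]
      by (simp add: form_compatible d_mult_d form_add_right form_smult_right a_minus_def)
    moreover have "\<omega> (s \<otimes>\<^bsub>A\<^esub> t) d = \<ominus> \<omega> (s \<otimes>\<^bsub>A\<^esub> d) t"
      using form_skew[of t "s \<otimes>\<^bsub>A\<^esub> d"] form_compatible[of s t d] by simp
    ultimately have "\<omega> ?S d = a \<otimes> (lam \<otimes> \<omega> t d \<ominus> \<omega> b\<^sub>0 t) \<oplus> (\<ominus> \<omega> (s \<otimes>\<^bsub>A\<^esub> d) t)"
      by (simp add: form_add_left form_smult_left form_self_mult)
    then show ?thesis by (simp add: a_minus_def r_distr r_minus m_lcomm[of a])
  qed
  ultimately show ?thesis
    using s t by (simp add: split_iso_split double_ext_alg_def quot_form_coset D_coset orth_line_mult)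
qed

lemma split_iso_alg_iso: "split_iso \<in> alg_iso K A E"
proof -
  have "split_iso (x \<oplus>\<^bsub>A\<^esub> y) = split_iso x \<oplus>\<^bsub>E\<^esub> split_iso y" if "x \<in> carrier A" "y \<in> carrier A" for x y
    using that orth_closed(1)[OF proj_mem] proj_mem
    by (simp add: split_iso_def double_ext_alg_def form_add_left form_add_right
        lin_End_simps[OF proj_lin_End] coset_add)
  moreover have "split_iso (a \<odot>\<^bsub>A\<^esub> x) = a \<odot>\<^bsub>E\<^esub> split_iso x" if "a \<in> carrier K" "x \<in> carrier A" for a x
    using that proj_mem
    by (simp add: split_iso_def double_ext_alg_def form_smult_left form_smult_right
        lin_End_simps[OF proj_lin_End] coset_smult)
  ultimately show ?thesis
    unfolding alg_iso_def bij_betw_def using split_iso_inj split_iso_surj split_iso_mult by blast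
qed

lemma split_iso_form:
  assumes x: "x \<in> carrier A" and y: "y \<in> carrier A"
  shows "double_ext_form K \<omega>\<^sub>B (split_iso x) (split_iso y) = \<omega> x y"
proof -
  obtain a s where s: "a \<in> carrier K" "s \<in> H" "x = a \<odot>\<^bsub>A\<^esub> d \<oplus>\<^bsub>A\<^esub> s" using x by (rule splitE)
  obtain b t where t: "b \<in> carrier K" "t \<in> H" "y = b \<odot>\<^bsub>A\<^esub> d \<oplus>\<^bsub>A\<^esub> t" using y by (rule splitE)
  have [simp]: "s \<in> carrier A" "t \<in> carrier A" using s t by (simp_all add: orth_closed)
  have "\<omega> x y = b \<otimes> \<omega> s d \<oplus> (a \<otimes> \<omega> d t \<oplus> \<omega> s t)"
    using s t by (simp add: form_add_left form_add_right form_smult_left form_smult_right form_self)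
  also have "\<omega> d t = \<ominus> \<omega> t d" by (rule form_skew) simp_all
  also have "b \<otimes> \<omega> s d \<oplus> (a \<otimes> (\<ominus> \<omega> t d) \<oplus> \<omega> s t) = \<omega> s t \<oplus> (\<omega> s d \<otimes> b \<ominus> a \<otimes> \<omega> t d)"
    using s(1) t(1) by (subst add_rotate) (simp_all add: a_minus_def r_minus m_comm[of b])
  finally show ?thesis using s t by (simp add: split_iso_split double_ext_form_def quot_form_coset)
qed

lemma is_double_extension: "is_double_extension K A \<omega> B \<omega>\<^sub>B D \<xi> (HI.coset b\<^sub>0) lam"
  unfolding is_double_extension_def
  using double_extension_data split_iso_alg_iso split_iso_form by blast

text \<open>Modulo \<open>H\<close> the algebra is the line on which \<open>\<omega> e\<close> is the coordinate.\<close>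

lemma quotient_line_alg: "alg_iso K (quot_alg A H) (line_alg K lam) \<noteq> {}"
proof -
  interpret AH: quotient_algebra K A H by unfold_locales (rule orth_line_ideal)
  interpret AH: surjective_alg_hom K A "quot_alg A H" "AH.coset" by (rule AH.coset_hom)
  define g where "g S = \<omega> e (SOME x. x \<in> carrier A \<and> AH.coset x = S)" for S
  have eq_iff: "AH.coset x = AH.coset y \<longleftrightarrow> \<omega> e x = \<omega> e y" if "x \<in> carrier A" "y \<in> carrier A" for x y
    using that by (simp add: AH.coset_eq_iff mem_orth_line_iff form_minus)
  have g: "g (AH.coset x) = \<omega> e x" if x: "x \<in> carrier A" for x
  proof -
    let ?y = "SOME y. y \<in> carrier A \<and> AH.coset y = AH.coset x"
    have "?y \<in> carrier A \<and> AH.coset ?y = AH.coset x" by (rule someI[of _ x]) (simp add: x)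
    then show ?thesis unfolding g_def using eq_iff[of ?y x] x by blast
  qed
  let ?Q = "quot_alg A H"
  have "inj_on g (carrier ?Q)"
  proof (rule inj_onI)
    fix S T assume S: "S \<in> carrier ?Q" and T: "T \<in> carrier ?Q" and eq: "g S = g T"
    obtain x where x: "x \<in> carrier A" "S = AH.coset x" using S by (rule AH.preimageE)
    obtain y where y: "y \<in> carrier A" "T = AH.coset y" using T by (rule AH.preimageE)
    show "S = T" using eq x y by (simp add: g eq_iff)
  qed
  moreover have "g ` carrier ?Q = carrier K"
  proof -
    have "g S \<in> carrier K" if "S \<in> carrier ?Q" for S
      using that by (rule AH.preimageE) (simp add: g)
    moreover have "a \<in> g ` carrier ?Q" if "a \<in> carrier K" for a
      using that g[of "a \<odot>\<^bsub>A\<^esub> d"] AH.hom_closed[of "a \<odot>\<^bsub>A\<^esub> d"]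
      by (intro image_eqI[of _ _ "AH.coset (a \<odot>\<^bsub>A\<^esub> d)"]) (simp_all add: form_smult_right)
    ultimately show ?thesis by blast
  qed
  moreover have "g (S \<oplus>\<^bsub>?Q\<^esub> T) = g S \<oplus> g T \<and> g (S \<otimes>\<^bsub>?Q\<^esub> T) = lam \<otimes> (g S \<otimes> g T)"
    if S: "S \<in> carrier ?Q" and T: "T \<in> carrier ?Q" for S T
  proof -
    obtain x where x: "x \<in> carrier A" "S = AH.coset x" using S by (rule AH.preimageE)
    obtain y where y: "y \<in> carrier A" "T = AH.coset y" using T by (rule AH.preimageE)
    from x y show ?thesis
      by (simp add: AH.hom_add[symmetric] AH.hom_mult[symmetric] g form_add_right form_e_mult m_assoc)
  qed
  moreover have "g (a \<odot>\<^bsub>?Q\<^esub> S) = a \<otimes> g S" if a: "a \<in> carrier K" and S: "S \<in> carrier ?Q" for a S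
  proof -
    obtain x where "x \<in> carrier A" "S = AH.coset x" using S by (rule AH.preimageE)
    then show ?thesis using a by (simp add: AH.hom_smult[symmetric] g form_smult_right)
  qed
  ultimately have "g \<in> alg_iso K ?Q (line_alg K lam)"
    by (auto simp: alg_iso_def bij_betw_def line_alg_def)
  then show ?thesis by blast
qed

end

section \<open>Existence of the ideal and the double extension\<close>

text \<open>
  Orthogonality of \<open>e\<close> to \<open>[u, d]\<close> reads \<open>\<omega>(u \<bullet> e, d) = \<omega>(d \<bullet> e, u)\<close>, and this expresses the eigenvalue
  of every left multiplication at \<open>e\<close> by that of \<open>d\<close>.
\<close>

lemma (in presymplectic_lsa_char_0) ex_invariant_line:
  assumes e: "e \<in> orth K A \<omega> (commutator_ideal K A)" "e \<in> commutator_ideal K A" "e \<noteq> \<zero>\<^bsub>A\<^esub>"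
    and eig: "\<And>u. u \<in> carrier A \<Longrightarrow> \<exists>\<alpha> \<in> carrier K. u \<otimes>\<^bsub>A\<^esub> e = \<alpha> \<odot>\<^bsub>A\<^esub> e"
  shows "\<exists>d lam. invariant_line K A \<omega> e d lam"
proof -
  note [simp] = form_closed prod_closed
  have eA [simp]: "e \<in> carrier A" using e(1) by (simp add: orth_def)
  obtain y where y: "y \<in> carrier A" "\<omega> e y \<noteq> \<zero>" using e(3) form_nondegenerate[of e] by auto
  define d where "d = inv (\<omega> e y) \<odot>\<^bsub>A\<^esub> y"
  have inv: "inv (\<omega> e y) \<in> carrier K" using y by (simp add: field_Units)
  have d [simp]: "d \<in> carrier A" unfolding d_def using inv y by simp
  have ed: "\<omega> e d = \<one>" unfolding d_def using inv y by (simp add: form_smult_right field_Units)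
  obtain lam where lam: "lam \<in> carrier K" "d \<otimes>\<^bsub>A\<^esub> e = lam \<odot>\<^bsub>A\<^esub> e" using eig[of d] by auto
  have "u \<otimes>\<^bsub>A\<^esub> e = (lam \<otimes> \<omega> e u) \<odot>\<^bsub>A\<^esub> e" if u: "u \<in> carrier A" for u
  proof -
    obtain \<alpha> where \<alpha>: "\<alpha> \<in> carrier K" "u \<otimes>\<^bsub>A\<^esub> e = \<alpha> \<odot>\<^bsub>A\<^esub> e" using eig u by blast
    have "\<omega> e (commutator A u d) = \<zero>"
      using e(1) commutator_mem[of u d] u by (simp add: orth_def)
    then have "\<omega> e (u \<otimes>\<^bsub>A\<^esub> d) = \<omega> e (d \<otimes>\<^bsub>A\<^esub> u)" using u by (simp add: commutator_def form_minus)
    then have "\<omega> (u \<otimes>\<^bsub>A\<^esub> e) d = \<omega> (d \<otimes>\<^bsub>A\<^esub> e) u" using u by (simp add: form_compatible)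
    then have "\<alpha> = lam \<otimes> \<omega> e u" using \<alpha> lam u ed by (simp add: form_smult_left)
    then show ?thesis using \<alpha> by simp
  qed
  then have "invariant_line K A \<omega> e d lam"
    using lam ed commutator_ideal_mult_zero[OF e(2)]
    by (intro invariant_line.intro invariant_line_axioms.intro presymplectic_lsa_char_0_axioms) auto
  then show ?thesis by blast
qed

theorem theorem6p6:
  fixes K :: "'k ring" and A :: "('k, 'a) module" and \<omega> :: "'a \<Rightarrow> 'a \<Rightarrow> 'k"
  assumes "algebraically_closed K"
    and "char_zero K"
    and "presymplectic_lsa K A \<omega>"
    and "degenerate K A \<omega> (commutator_ideal K A)"
  shows "\<exists>I. two_sided_ideal K A I \<and> one_dimensional K A I \<and> totally_isotropic K A \<omega> I \<and>
      I \<subseteq> commutator_ideal K A \<inter> orth K A \<omega> (commutator_ideal K A) \<and>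
      (\<exists>D \<xi> b0 lam.
         alg_iso K (quot_alg A (orth K A \<omega> I)) (line_alg K lam) \<noteq> {} \<and>
         is_double_extension K A \<omega>
           (quot_alg (subalg A (orth K A \<omega> I)) I) (quot_form \<omega>) D \<xi> b0 lam)"
proof -
  interpret presymplectic_lsa_char_0 K A \<omega>
    using assms(2,3) by (intro presymplectic_lsa_char_0.intro presymplectic_lsa_char_0_axioms.intro)
  let ?C = "commutator_ideal K A"
  obtain e where e: "e \<in> ?C" "e \<in> orth K A \<omega> ?C" "e \<noteq> \<zero>\<^bsub>A\<^esub>"
    "\<And>u. u \<in> carrier A \<Longrightarrow> \<exists>\<alpha> \<in> carrier K. u \<otimes>\<^bsub>A\<^esub> e = \<alpha> \<odot>\<^bsub>A\<^esub> e"
    using ex_common_eigenvector_left_mult[OF assms(1,4)] by blast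
  obtain d lam where "invariant_line K A \<omega> e d lam"
    using ex_invariant_line[OF e(2,1,3,4)] by blast
  then interpret L: invariant_line K A \<omega> e d lam .
  have C: "?C \<subseteq> carrier A" using submodule_closed(1)[OF commutator_ideal_submodule] by blast
  have "L.line \<subseteq> ?C \<inter> orth K A \<omega> ?C"
    using e(1,2) submodule_closed(5)[OF commutator_ideal_submodule]
      submodule_closed(5)[OF orth_submodule[OF C]]
    by (auto elim!: L.lineE)
  moreover have "one_dimensional K A L.line"
    unfolding one_dimensional_def L.line_def using e(3) L.e_closed by blast
  ultimately show ?thesis
    using L.line_ideal L.line_isotropic L.quotient_line_alg L.is_double_extension by blast
qed

end
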